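(* Let $k\ge 1$, $t\in\mathbb{R}$ and $0\le\beta\le\frac{(k+1)(k+2)}{2}$. There exists a compact set $E_{t,\beta}\subset\{x=t\}\subset J^k(\mathbb{R})$ such that for all $f\in C^\infty(\mathbb{R})$, $$\dim_{\mathrm{Hau}}V_{f,t}(E_{t,\beta})=\beta\quad\text{and}\quad\dim_{\mathrm{Hau}}J_{f,t}(E_{t,\beta})=0.$$
   Context: Let $k\ge 1$ be an integer. The jet space Carnot group $J^k(\mathbb{R})$ is the set $\mathbb{R}^{k+2}$, with points written $(x,u_k,\ldots,u_0)$, equipped with the group operation $(x,u_k,\ldots,u_0)\odot(y,v_k,\ldots,v_0)=(x+y,w_k,\ldots,w_0)$, where $w_k=u_k+v_k$ and $w_s=u_s+v_s+\sum_{j=s+1}^k u_j\frac{y^{j-s}}{(j-s)!}$ for $s=0,\ldots,k-1$; inverses $p^{-1}$ are with respect to $\odot$. The horizontal bundle is framed by the left-invariant vector fields $X^{(k)}=\frac{\partial}{\partial x}+u_k\frac{\partial}{\partial u_{k-1}}+\cdots+u_1\frac{\partial}{\partial u_0}$ and $\frac{\partial}{\partial u_k}$, declared orthonormal; a horizontal curve is a curve that is absolutely continuous into $\mathbb{R}^{k+2}$ and whose derivative lies a.e. in the horizontal bundle. The Carnot–Carathéodory distance $d_{cc}(p,q)$ is the infimum of lengths of horizontal curves connecting $p$ to $q$. $\dim_{\mathrm{Hau}}$ of subsets of $J^k(\mathbb{R})$ is Hausdorff dimension with respect to $d_{cc}$ (with $\dim_{\mathrm{Hau}}\emptyset=0$).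 For $f\in C^\infty(\mathbb{R})$ and $x\in\mathbb{R}$, $j^k_x(f):=j^k(f)(x):=(x,f^{(k)}(x),f^{(k-1)}(x),\ldots,f(x))\in J^k(\mathbb{R})$, and $\mathrm{im}(j^k(f)):=\{j^k_x(f):x\in\mathbb{R}\}$. For $t\in\mathbb{R}$, $\{x=t\}:=\{(x,u_k,\ldots,u_0)\in J^k(\mathbb{R}):x=t\}$. For $f\in C^\infty(\mathbb{R})$ and $t\in\mathbb{R}$, the vertical mapping $V_{f,t}:J^k(\mathbb{R})\to\{x=t\}$ and the horizontal mapping $J_{f,t}:J^k(\mathbb{R})\to\mathrm{im}(j^k(f))$ are $V_{f,t}(x,u_k,\ldots,u_0):=(x,u_k,\ldots,u_0)\odot j^k_{x-t}(f)^{-1}$ and $J_{f,t}(x,u_k,\ldots,u_0):=j^k_{x-t}(f)$. *)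

theory Defs
  imports "HOL-Analysis.Analysis" "HOL-Algebra.Group"
begin

section \<open>The jet space Carnot group\<close>

text \<open>
  The point \<open>(x, u\<^sub>k, \<dots>, u\<^sub>0)\<close> is encoded as the pair \<open>(x, u)\<close> with \<open>u s = u\<^sub>s\<close> for \<open>s \<le> k\<close>
  and \<open>u s = 0\<close> for \<open>s > k\<close>.  The topology on \<^typ>\<open>real \<times> (nat \<Rightarrow> real)\<close> is the product
  topology, which induces on \<open>jet_space k\<close> the usual topology of \<open>k + 2\<close>-dimensional space; in
  particular \<open>compact\<close> has its usual meaning for subsets of \<open>jet_space k\<close>.
\<close>

type_synonym jet = "real \<times> (nat \<Rightarrow> real)"

definition jet_space :: "nat \<Rightarrow> jet set" where
  "jet_space k = {p. \<forall>s>k. snd p s = 0}"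

text \<open>For \<open>s = k\<close> the sum below is empty, so that case needs no separate clause.\<close>

definition jet_mult :: "nat \<Rightarrow> jet \<Rightarrow> jet \<Rightarrow> jet" where
  "jet_mult k p q =
     (fst p + fst q,
      \<lambda>s. if s \<le> k
          then snd p s + snd q s + (\<Sum>j=s+1..k. snd p j * (fst q ^ (j - s) / fact (j - s)))
          else 0)"

definition jet_group :: "nat \<Rightarrow> jet monoid" where
  "jet_group k = \<lparr>carrier = jet_space k, mult = jet_mult k, one = (0, \<lambda>_. 0)\<rparr>"

lemma jet_mult_coord:
  assumes "s \<le> k"
  shows "snd (jet_mult k p q) s = snd q s + (\<Sum>j=s..k. snd p j * (fst q ^ (j - s) / fact (j - s)))"
  using assms by (simp add: jet_mult_def sum.atLeast_Suc_atMost)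

lemma jet_mult_assoc: "jet_mult k (jet_mult k p q) r = jet_mult k p (jet_mult k q r)"
proof -
  define a b where "a = fst q" and "b = fst r"
  have "snd (jet_mult k (jet_mult k p q) r) s = snd (jet_mult k p (jet_mult k q r)) s" for s
  proof (cases "s \<le> k")
    case True
    have binom: "(\<Sum>j=s..i. a ^ (i - j) / fact (i - j) * (b ^ (j - s) / fact (j - s)))
                   = (a + b) ^ (i - s) / fact (i - s)" if "s \<le> i" for i
    proof -
      have "(\<Sum>j=s..i. a ^ (i - j) / fact (i - j) * (b ^ (j - s) / fact (j - s)))
              = (\<Sum>m\<le>i - s. a ^ (i - s - m) / fact (i - s - m) * (b ^ m / fact m))"
        using that by (intro sum.reindex_bij_witness[of _ "\<lambda>m. m + s" "\<lambda>j. j - s"]) auto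
      also have "\<dots> = (\<Sum>m\<le>i - s. of_nat ((i - s) choose m) * b ^ m * a ^ (i - s - m)) / fact (i - s)"
        unfolding sum_divide_distrib by (intro sum.cong) (auto simp: binomial_fact field_simps)
      also have "\<dots> = (a + b) ^ (i - s) / fact (i - s)"
        by (simp add: binomial_ring[of b a] add.commute[of a b])
      finally show ?thesis .
    qed
    have "(\<Sum>j=s..k. (\<Sum>i=j..k. snd p i * (a ^ (i - j) / fact (i - j))) * (b ^ (j - s) / fact (j - s)))
            = (\<Sum>j=s..k. \<Sum>i=j..k.
                 snd p i * (a ^ (i - j) / fact (i - j) * (b ^ (j - s) / fact (j - s))))"
      by (simp only: sum_distrib_right mult.assoc)
    also have "\<dots> = (\<Sum>i=s..k. \<Sum>j=s..i.
                 snd p i * (a ^ (i - j) / fact (i - j) * (b ^ (j - s) / fact (j - s))))"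
      by (subst sum.Sigma; simp?; subst sum.Sigma; simp?)
         (rule sum.reindex_bij_witness[of _ "\<lambda>(i, j). (j, i)" "\<lambda>(i, j). (j, i)"]; auto)
    also have "\<dots> = (\<Sum>i=s..k. snd p i * ((a + b) ^ (i - s) / fact (i - s)))"
      by (intro sum.cong refl) (simp only: sum_distrib_left[symmetric] binom atLeastAtMost_iff)
    finally have "(\<Sum>j=s..k. (\<Sum>i=j..k. snd p i * (a ^ (i - j) / fact (i - j)))
                     * (b ^ (j - s) / fact (j - s)))
            = (\<Sum>i=s..k. snd p i * ((a + b) ^ (i - s) / fact (i - s)))" .
    moreover have "fst (jet_mult k q r) = a + b"
      by (simp add: jet_mult_def a_def b_def)
    ultimately show ?thesis
      using True
      by (simp add: jet_mult_coord a_def[symmetric] b_def[symmetric] ring_distribs sum.distrib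
            add_divide_distrib)
  qed (simp add: jet_mult_def)
  then show ?thesis
    by (auto simp: prod_eq_iff jet_mult_def)
qed

lemma group_jet_group: "Group.group (jet_group k)"
proof (rule groupI, goal_cases)
  case (5 p)
  define q :: jet where
    "q = (- fst p, \<lambda>s. if s \<le> k
                       then - (\<Sum>j=s..k. snd p j * ((- fst p) ^ (j - s) / fact (j - s))) else 0)"
  have q: "q \<in> jet_space k" and pq: "jet_mult k p q = (0, \<lambda>_. 0)"
    by (auto simp: q_def jet_space_def jet_mult_def sum.atLeast_Suc_atMost)
  define r :: jet where
    "r = (- fst q, \<lambda>s. if s \<le> k
                       then - (\<Sum>j=s..k. snd q j * ((- fst q) ^ (j - s) / fact (j - s))) else 0)"
  have r: "r \<in> jet_space k" and qr: "jet_mult k q r = (0, \<lambda>_. 0)"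
    by (auto simp: r_def jet_space_def jet_mult_def sum.atLeast_Suc_atMost)
  have unit: "jet_mult k z (0, \<lambda>_. 0) = z" "jet_mult k (0, \<lambda>_. 0) z = z" if "z \<in> jet_space k" for z
    using that by (auto simp: jet_mult_def jet_space_def prod_eq_iff fun_eq_iff power_0_left
                        intro!: sum.neutral)
  have "p = r"
    using jet_mult_assoc[of k p q r] unit r 5 by (simp add: pq qr jet_group_def)
  with q qr show ?case
    by (auto simp: jet_group_def)
next
  case (3 p q r)
  then show ?case
    by (simp add: jet_group_def jet_mult_assoc)
qed (auto simp: jet_group_def jet_space_def jet_mult_def prod_eq_iff fun_eq_iff)


section \<open>The Carnot--Caratheodory distance\<close>

text \<open>The horizontal frame: \<open>frame_X k\<close> is the field \<open>X\<^sup>(\<^sup>k\<^sup>)\<close> and \<open>frame_U k\<close> the field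
  \<open>\<partial>/\<partial>u\<^sub>k\<close>; a tangent vector is recorded by its coordinates, as an element of \<^typ>\<open>jet\<close>.\<close>

definition frame_X :: "nat \<Rightarrow> jet \<Rightarrow> jet" where
  "frame_X k p = (1, \<lambda>s. if s < k then snd p (Suc s) else 0)"

definition frame_U :: "nat \<Rightarrow> jet \<Rightarrow> jet" where
  "frame_U k p = (0, \<lambda>s. if s = k then 1 else 0)"

definition horizontal_space :: "nat \<Rightarrow> jet \<Rightarrow> jet set" where
  "horizontal_space k p =
     {(\<alpha> * fst (frame_X k p) + \<beta> * fst (frame_U k p),
       \<lambda>s. \<alpha> * snd (frame_X k p) s + \<beta> * snd (frame_U k p) s) | \<alpha> \<beta>. True}"

definition abs_continuous :: "real \<Rightarrow> real \<Rightarrow> (real \<Rightarrow> real) \<Rightarrow> bool" where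
  "abs_continuous a b g \<longleftrightarrow>
     (\<forall>\<epsilon>>0. \<exists>\<delta>>0. \<forall>D.
        finite D \<and> (\<forall>(u, v)\<in>D. a \<le> u \<and> u \<le> v \<and> v \<le> b)
        \<and> disjoint_family_on (\<lambda>(u, v). {u<..<v}) D \<and> (\<Sum>(u, v)\<in>D. v - u) < \<delta>
        \<longrightarrow> (\<Sum>(u, v)\<in>D. \<bar>g v - g u\<bar>) < \<epsilon>)"

definition jet_velocity :: "(real \<Rightarrow> jet) \<Rightarrow> real \<Rightarrow> jet \<Rightarrow> bool" where
  "jet_velocity \<gamma> \<tau> v \<longleftrightarrow>
     ((\<lambda>\<sigma>. fst (\<gamma> \<sigma>)) has_real_derivative fst v) (at \<tau>)
     \<and> (\<forall>s. ((\<lambda>\<sigma>. snd (\<gamma> \<sigma>) s) has_real_derivative snd v s) (at \<tau>))"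

text \<open>Absolute continuity into a finite-dimensional space is absolute continuity of each
  coordinate.\<close>

definition horizontal_curve :: "nat \<Rightarrow> real \<Rightarrow> real \<Rightarrow> (real \<Rightarrow> jet) \<Rightarrow> bool" where
  "horizontal_curve k a b \<gamma> \<longleftrightarrow>
     \<gamma> ` {a..b} \<subseteq> jet_space k
     \<and> abs_continuous a b (\<lambda>\<tau>. fst (\<gamma> \<tau>))
     \<and> (\<forall>s\<le>k. abs_continuous a b (\<lambda>\<tau>. snd (\<gamma> \<tau>) s))
     \<and> (AE \<tau> in lborel. \<tau> \<in> {a<..<b} \<longrightarrow> (\<exists>v\<in>horizontal_space k (\<gamma> \<tau>). jet_velocity \<gamma> \<tau> v))"

text \<open>If \<open>\<gamma>' = \<alpha> X\<^sup>(\<^sup>k\<^sup>) + \<beta> \<partial>/\<partial>u\<^sub>k\<close>, then \<open>\<alpha> = x'\<close> and \<open>\<beta> = u\<^sub>k'\<close>; as the frame is orthonormal, the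
  speed is \<open>sqrt (\<alpha>\<^sup>2 + \<beta>\<^sup>2)\<close>.\<close>

definition horizontal_length :: "nat \<Rightarrow> real \<Rightarrow> real \<Rightarrow> (real \<Rightarrow> jet) \<Rightarrow> ennreal" where
  "horizontal_length k a b \<gamma> =
     (\<integral>\<^sup>+\<tau>\<in>{a..b}. ennreal (sqrt ((deriv (\<lambda>\<sigma>. fst (\<gamma> \<sigma>)) \<tau>)\<^sup>2 + (deriv (\<lambda>\<sigma>. snd (\<gamma> \<sigma>) k) \<tau>)\<^sup>2)) \<partial>lborel)"

definition d_cc :: "nat \<Rightarrow> jet \<Rightarrow> jet \<Rightarrow> ennreal" where
  "d_cc k p q =
     Inf {horizontal_length k a b \<gamma> | a b \<gamma>.
            a \<le> b \<and> horizontal_curve k a b \<gamma> \<and> \<gamma> a = p \<and> \<gamma> b = q}"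


section \<open>Hausdorff dimension of subsets of a space \<open>M\<close> with distance \<open>d\<close>\<close>

definition ediam :: "('a \<Rightarrow> 'a \<Rightarrow> ennreal) \<Rightarrow> 'a set \<Rightarrow> ennreal" where
  "ediam d A = (SUP p\<in>A. SUP q\<in>A. d p q)"

text \<open>The term \<open>(diam A)\<^sup>s\<close>, with the usual conventions \<open>(diam {})\<^sup>s = 0\<close> and \<open>0\<^sup>0 = 1\<close> for
  nonempty \<open>A\<close> (whereas \<open>0 powr 0 = 0\<close>).  It is used only for sets of finite diameter.\<close>

definition diam_power :: "('a \<Rightarrow> 'a \<Rightarrow> ennreal) \<Rightarrow> real \<Rightarrow> 'a set \<Rightarrow> ennreal" where
  "diam_power d s A =
     (if A = {} then 0 else if s = 0 then 1 else ennreal (enn2real (ediam d A) powr s))"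

definition hausdorff_premeasure ::
    "'a set \<Rightarrow> ('a \<Rightarrow> 'a \<Rightarrow> ennreal) \<Rightarrow> real \<Rightarrow> real \<Rightarrow> 'a set \<Rightarrow> ennreal" where
  "hausdorff_premeasure M d s \<delta> A =
     (INF C \<in> {C :: nat \<Rightarrow> 'a set. (\<forall>i. C i \<subseteq> M \<and> ediam d (C i) \<le> ennreal \<delta>) \<and> A \<subseteq> (\<Union>i. C i)}.
        \<Sum>i. diam_power d s (C i))"

definition hausdorff_measure ::
    "'a set \<Rightarrow> ('a \<Rightarrow> 'a \<Rightarrow> ennreal) \<Rightarrow> real \<Rightarrow> 'a set \<Rightarrow> ennreal" where
  "hausdorff_measure M d s A = (SUP \<delta>\<in>{0<..}. hausdorff_premeasure M d s \<delta> A)"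

definition hausdorff_dim :: "'a set \<Rightarrow> ('a \<Rightarrow> 'a \<Rightarrow> ennreal) \<Rightarrow> 'a set \<Rightarrow> ennreal" where
  "hausdorff_dim M d A = Inf {ennreal s | s. 0 \<le> s \<and> hausdorff_measure M d s A = 0}"

abbreviation jet_hausdorff_dim :: "nat \<Rightarrow> jet set \<Rightarrow> ennreal" where
  "jet_hausdorff_dim k \<equiv> hausdorff_dim (jet_space k) (d_cc k)"


section \<open>Jets of smooth functions and the vertical and horizontal mappings\<close>

definition smooth :: "(real \<Rightarrow> real) \<Rightarrow> bool" where
  "smooth f \<longleftrightarrow> (\<forall>n x. (deriv ^^ n) f differentiable (at x))"

definition jet_of :: "nat \<Rightarrow> (real \<Rightarrow> real) \<Rightarrow> real \<Rightarrow> jet" where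
  "jet_of k f x = (x, \<lambda>s. if s \<le> k then (deriv ^^ s) f x else 0)"

definition jet_slice :: "nat \<Rightarrow> real \<Rightarrow> jet set" where
  "jet_slice k t = {p \<in> jet_space k. fst p = t}"

definition vertical_map :: "nat \<Rightarrow> (real \<Rightarrow> real) \<Rightarrow> real \<Rightarrow> jet \<Rightarrow> jet" where
  "vertical_map k f t p =
     p \<otimes>\<^bsub>jet_group k\<^esub> inv\<^bsub>jet_group k\<^esub> (jet_of k f (fst p - t))"

definition horizontal_map :: "nat \<Rightarrow> (real \<Rightarrow> real) \<Rightarrow> real \<Rightarrow> jet \<Rightarrow> jet" where
  "horizontal_map k f t p = jet_of k f (fst p - t)"

end

theory Submission
  imports Defs
begin

text \<open>
  Every point of a set \<open>E\<close> in the slice \<open>{x = t}\<close> has \<open>x - t = 0\<close>.  Hence the horizontal mapping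
  sends \<open>E\<close> to the single point \<open>j\<^sup>k\<^sub>0(f)\<close>, and the vertical mapping multiplies \<open>E\<close> on the right
  by the inverse of that jet, which on the slice is the subtraction of a fixed vector
  (\<open>vertical_map_on_slice\<close>).  So it suffices to find one compact \<open>E\<close> all of whose translates
  inside the slice have dimension \<open>\<beta>\<close>.

  On the slice \<open>d_cc\<close> is comparable with
  \<open>max\<^sub>s \<bar>u\<^sub>s - v\<^sub>s\<bar> powr (1 / (k + 1 - s))\<close>: a horizontal curve of length \<open>l\<close> that returns to the
  slice moves \<open>u\<^sub>s\<close> by at most \<open>l ^ (k + 1 - s)\<close> (\<open>d_cc_vertical_lower_bound\<close>), and going out along
  the jet of one polynomial and coming back along the jet of another realises such displacements
  at a cost proportional to \<open>l\<close> (\<open>d_cc_vertical_upper_bound\<close>).  Both estimates involve the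
  difference of the two points only, so they do not see translations.

  The slice thus behaves like a product of \<open>k + 1\<close> lines, the line of \<open>u\<^sub>s\<close> having dimension
  \<open>k + 1 - s\<close>; the total is \<open>Q = (k + 1) (k + 2) / 2\<close>.  Put \<open>\<theta> = \<beta> / Q\<close> and let \<open>E\<close> be the product
  of \<open>k + 1\<close> copies of one Cantor set \<open>C\<close> of the real line, of dimension \<open>\<theta>\<close> and contraction ratio
  \<open>\<lambda> = 2 powr (- 1 / \<theta>)\<close>.  If in coordinate \<open>s\<close> the set \<open>C\<close> is cut into the \<open>2 ^ (m (k + 1 - s))\<close>
  pieces of level \<open>m (k + 1 - s)\<close>, each piece has length about \<open>(\<lambda> ^ m) ^ (k + 1 - s)\<close>.  This gives
  \<open>2 ^ (m Q)\<close> boxes of \<open>d_cc\<close>-diameter about \<open>\<lambda> ^ m\<close>, and \<open>2 ^ Q = (1 / \<lambda>) powr (\<theta> Q)\<close>, so the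
  dimension is at most \<open>\<theta> Q = \<beta>\<close> (\<open>hausdorff_dim_coded_translate_le\<close>).

  For the converse, \<open>C\<close> is the closure of the image of \<open>[0, 1)\<close> under a map \<open>G\<close> whose inverse is
  \<open>\<theta>\<close>-Hoelder (\<open>cantor_coding_exists\<close>).  A subset of \<open>E\<close> of diameter \<open>e\<close> therefore pulls back to a
  subset of \<open>[0, 1) ^ (k + 1)\<close> inside a box with sides of order \<open>e powr ((k + 1 - s) \<theta>)\<close>, that is,
  of volume of order \<open>e powr \<beta>\<close>.  Lebesgue measure of the cube then serves as the mass
  distribution (\<open>hausdorff_dim_coded_translate_ge\<close>).
\<close>

section \<open>Absolutely continuous functions\<close>

lemma abs_continuous_subinterval:
  assumes "abs_continuous a b g" "a \<le> c" "d \<le> b"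
  shows "abs_continuous c d g"
  unfolding abs_continuous_def
proof (intro allI impI)
  fix e :: real assume "0 < e"
  then obtain \<delta> where "\<delta> > 0" and \<delta>: "\<And>D. finite D \<and> (\<forall>(u, v)\<in>D. a \<le> u \<and> u \<le> v \<and> v \<le> b)
        \<and> disjoint_family_on (\<lambda>(u, v). {u<..<v}) D \<and> (\<Sum>(u, v)\<in>D. v - u) < \<delta>
        \<Longrightarrow> (\<Sum>(u, v)\<in>D. \<bar>g v - g u\<bar>) < e"
    using assms(1) unfolding abs_continuous_def by meson
  show "\<exists>\<delta>>0. \<forall>D. finite D \<and> (\<forall>(u, v)\<in>D. c \<le> u \<and> u \<le> v \<and> v \<le> d)
        \<and> disjoint_family_on (\<lambda>(u, v). {u<..<v}) D \<and> (\<Sum>(u, v)\<in>D. v - u) < \<delta>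
        \<longrightarrow> (\<Sum>(u, v)\<in>D. \<bar>g v - g u\<bar>) < e"
    by (rule exI[of _ \<delta>], intro conjI allI impI \<delta>) (use \<open>\<delta> > 0\<close> assms(2,3) in force)+
qed

lemma abs_continuous_imp_continuous_on:
  assumes "abs_continuous a b g"
  shows "continuous_on {a..b} g"
  unfolding continuous_on_iff
proof (intro ballI allI impI)
  fix x e :: real assume x: "x \<in> {a..b}" and "0 < e"
  then obtain \<delta> where "\<delta> > 0" and \<delta>: "\<And>D. finite D \<and> (\<forall>(u, v)\<in>D. a \<le> u \<and> u \<le> v \<and> v \<le> b)
        \<and> disjoint_family_on (\<lambda>(u, v). {u<..<v}) D \<and> (\<Sum>(u, v)\<in>D. v - u) < \<delta>
        \<Longrightarrow> (\<Sum>(u, v)\<in>D. \<bar>g v - g u\<bar>) < e"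
    using assms(1) unfolding abs_continuous_def by meson
  have "\<bar>g y - g x\<bar> < e" if "y \<in> {a..b}" "\<bar>y - x\<bar> < \<delta>" for y
    using \<delta>[of "{(x, y)}"] \<delta>[of "{(y, x)}"] that x
    by (cases "x \<le> y") (auto simp: disjoint_family_on_def abs_minus_commute)
  then show "\<exists>d>0. \<forall>x'\<in>{a..b}. dist x' x < d \<longrightarrow> dist (g x') (g x) < e"
    using \<open>\<delta> > 0\<close> by (auto simp: dist_real_def)
qed

text \<open>
  The common source of the closure properties that follow: sums, products and Lipschitz images
  all have increments controlled by those of the functions they are built from.
\<close>
lemma abs_continuous_bounded_increments:
  assumes f: "abs_continuous a b f" and g: "abs_continuous a b g" and "0 \<le> M" "0 \<le> N"
    and h: "\<And>u v. a \<le> u \<Longrightarrow> u \<le> v \<Longrightarrow> v \<le> b \<Longrightarrow> \<bar>h v - h u\<bar> \<le> M * \<bar>f v - f u\<bar> + N * \<bar>g v - g u\<bar>"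
  shows "abs_continuous a b h"
  unfolding abs_continuous_def
proof (intro allI impI)
  fix e :: real assume "0 < e"
  define e1 where "e1 = e / (2 * (M + N + 1))"
  have "e1 > 0" using \<open>0 < e\<close> assms by (simp add: e1_def)
  then obtain d1 where d1: "d1 > 0" "\<And>D. finite D \<and> (\<forall>(u, v)\<in>D. a \<le> u \<and> u \<le> v \<and> v \<le> b)
        \<and> disjoint_family_on (\<lambda>(u, v). {u<..<v}) D \<and> (\<Sum>(u, v)\<in>D. v - u) < d1
        \<Longrightarrow> (\<Sum>(u, v)\<in>D. \<bar>f v - f u\<bar>) < e1"
    using f unfolding abs_continuous_def by meson
  obtain d2 where d2: "d2 > 0" "\<And>D. finite D \<and> (\<forall>(u, v)\<in>D. a \<le> u \<and> u \<le> v \<and> v \<le> b)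
        \<and> disjoint_family_on (\<lambda>(u, v). {u<..<v}) D \<and> (\<Sum>(u, v)\<in>D. v - u) < d2
        \<Longrightarrow> (\<Sum>(u, v)\<in>D. \<bar>g v - g u\<bar>) < e1"
    using g \<open>e1 > 0\<close> unfolding abs_continuous_def by meson
  show "\<exists>\<delta>>0. \<forall>D. finite D \<and> (\<forall>(u, v)\<in>D. a \<le> u \<and> u \<le> v \<and> v \<le> b)
        \<and> disjoint_family_on (\<lambda>(u, v). {u<..<v}) D \<and> (\<Sum>(u, v)\<in>D. v - u) < \<delta>
        \<longrightarrow> (\<Sum>(u, v)\<in>D. \<bar>h v - h u\<bar>) < e"
  proof (rule exI[of _ "min d1 d2"], intro conjI allI impI)
    fix D :: "(real \<times> real) set"
    assume D: "finite D \<and> (\<forall>(u, v)\<in>D. a \<le> u \<and> u \<le> v \<and> v \<le> b)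
        \<and> disjoint_family_on (\<lambda>(u, v). {u<..<v}) D \<and> (\<Sum>(u, v)\<in>D. v - u) < min d1 d2"
    have "(\<Sum>(u, v)\<in>D. \<bar>h v - h u\<bar>) \<le> (\<Sum>(u, v)\<in>D. M * \<bar>f v - f u\<bar> + N * \<bar>g v - g u\<bar>)"
      using D by (intro sum_mono) (auto intro!: h)
    also have "\<dots> = M * (\<Sum>(u, v)\<in>D. \<bar>f v - f u\<bar>) + N * (\<Sum>(u, v)\<in>D. \<bar>g v - g u\<bar>)"
      by (simp add: sum.distrib sum_distrib_left split_def)
    also have "\<dots> \<le> M * e1 + N * e1"
      using d1(2)[of D] d2(2)[of D] D assms by (intro add_mono mult_left_mono) auto
    also have "\<dots> < e"
    proof -
      have "(M + N) * e < (2 * (M + N + 1)) * e"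
        using \<open>0 < e\<close> assms by (intro mult_strict_right_mono) auto
      then have "(M + N) * e / (2 * (M + N + 1)) < e"
        using assms by (simp add: divide_less_eq mult.commute)
      then show ?thesis unfolding e1_def by (simp add: add_divide_distrib algebra_simps)
    qed
    finally show "(\<Sum>(u, v)\<in>D. \<bar>h v - h u\<bar>) < e" .
  qed (use d1 d2 in auto)
qed

lemma lipschitz_imp_abs_continuous:
  assumes "L-lipschitz_on {a..b} h"
  shows "abs_continuous a b h"
proof -
  have id: "abs_continuous a b (\<lambda>x. x)"
    unfolding abs_continuous_def
  proof (intro allI impI)
    fix e :: real assume "e > 0"
    have "(\<Sum>(u, v)\<in>D. \<bar>v - u\<bar>) = (\<Sum>(u, v)\<in>D. v - u)"
      if "\<forall>(u, v)\<in>D. a \<le> u \<and> u \<le> v \<and> v \<le> b" for D :: "(real \<times> real) set"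
      using that by (intro sum.cong) auto
    then show "\<exists>\<delta>>0. \<forall>D. finite D \<and> (\<forall>(u, v)\<in>D. a \<le> u \<and> u \<le> v \<and> v \<le> b)
        \<and> disjoint_family_on (\<lambda>(u, v). {u<..<v}) D \<and> (\<Sum>(u, v)\<in>D. v - u) < \<delta>
        \<longrightarrow> (\<Sum>(u, v)\<in>D. \<bar>v - u\<bar>) < e"
      using \<open>e > 0\<close> by (intro exI[of _ e]) auto
  qed
  show ?thesis
  proof (rule abs_continuous_bounded_increments[OF id id, of L 0])
    fix u v assume "a \<le> u" "u \<le> v" "v \<le> b"
    then show "\<bar>h v - h u\<bar> \<le> L * \<bar>v - u\<bar> + 0 * \<bar>v - u\<bar>"
      using lipschitz_onD[OF assms, of v u] by (simp add: dist_real_def)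
  qed (use lipschitz_on_nonneg[OF assms] in auto)
qed

lemma abs_continuous_const: "abs_continuous a b (\<lambda>_. c)"
  by (rule lipschitz_imp_abs_continuous[of 0]) (auto simp: lipschitz_on_def)

lemma abs_continuous_add:
  assumes "abs_continuous a b f" "abs_continuous a b g"
  shows "abs_continuous a b (\<lambda>x. f x + g x)"
  by (rule abs_continuous_bounded_increments[OF assms, of 1 1]) auto

lemma abs_continuous_mult:
  assumes f: "abs_continuous a b f" and g: "abs_continuous a b g"
  shows "abs_continuous a b (\<lambda>x. f x * g x)"
proof -
  have "bounded (f ` {a..b})" "bounded (g ` {a..b})"
    using f g by (auto intro!: compact_imp_bounded compact_continuous_image
        abs_continuous_imp_continuous_on)
  then obtain M N where M: "0 < M" "\<And>x. x \<in> {a..b} \<Longrightarrow> \<bar>f x\<bar> \<le> M"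
    and N: "0 < N" "\<And>x. x \<in> {a..b} \<Longrightarrow> \<bar>g x\<bar> \<le> N"
    unfolding bounded_pos by auto
  show ?thesis
  proof (rule abs_continuous_bounded_increments[OF f g, of N M])
    fix u v assume uv: "a \<le> u" "u \<le> v" "v \<le> b"
    have "\<bar>f v * g v - f u * g u\<bar> = \<bar>(f v - f u) * g v + f u * (g v - g u)\<bar>"
      by (simp add: algebra_simps)
    also have "\<dots> \<le> \<bar>f v - f u\<bar> * \<bar>g v\<bar> + \<bar>f u\<bar> * \<bar>g v - g u\<bar>"
      by (metis abs_triangle_ineq abs_mult)
    also have "\<dots> \<le> N * \<bar>f v - f u\<bar> + M * \<bar>g v - g u\<bar>"
      using uv M N by (intro add_mono) (auto simp: mult.commute intro!: mult_right_mono)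
    finally show "\<bar>f v * g v - f u * g u\<bar> \<le> N * \<bar>f v - f u\<bar> + M * \<bar>g v - g u\<bar>" .
  qed (use M N in auto)
qed

lemma abs_continuous_sum:
  assumes "\<And>i. i \<in> I \<Longrightarrow> abs_continuous a b (f i)"
  shows "abs_continuous a b (\<lambda>x. \<Sum>i\<in>I. f i x)"
  using assms
  by (induction I rule: infinite_finite_induct) (auto intro: abs_continuous_const abs_continuous_add)

lemma abs_continuous_power:
  assumes "abs_continuous a b f"
  shows "abs_continuous a b (\<lambda>x. f x ^ n)"
  using assms by (induction n) (auto intro: abs_continuous_const abs_continuous_mult)

text \<open>
  The null set \<open>N\<close> lies in an open set of small measure.  In a fine tagged partition the
  intervals tagged in \<open>N\<close> stay inside that open set, so by absolute continuity the increments of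
  \<open>g\<close> over them sum to little; on the other intervals the increment is close to \<open>D x\<close> times the
  length.
\<close>
theorem abs_continuous_has_integral:
  fixes g D :: "real \<Rightarrow> real"
  assumes "a \<le> b" and ac: "abs_continuous a b g" and N: "negligible N"
    and D: "\<And>x. x \<in> {a..b} - N \<Longrightarrow> (g has_real_derivative D x) (at x)"
    and D0: "\<And>x. x \<in> N \<Longrightarrow> D x = 0"
  shows "(D has_integral (g b - g a)) {a..b}"
proof (cases "a = b")
  case False
  with \<open>a \<le> b\<close> have "a < b" by simp
  show ?thesis
    unfolding has_integral_factor_content_real
  proof (intro allI impI)
    fix e :: real assume "e > 0"
    define e' where "e' = e * (b - a) / 2"
    have "e' > 0" using \<open>e > 0\<close> \<open>a < b\<close> by (simp add: e'_def)
    then obtain \<delta> where "\<delta> > 0" and \<delta>: "\<And>D. finite D \<and> (\<forall>(u, v)\<in>D. a \<le> u \<and> u \<le> v \<and> v \<le> b)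
        \<and> disjoint_family_on (\<lambda>(u, v). {u<..<v}) D \<and> (\<Sum>(u, v)\<in>D. v - u) < \<delta>
        \<Longrightarrow> (\<Sum>(u, v)\<in>D. \<bar>g v - g u\<bar>) < e'"
      using ac unfolding abs_continuous_def by meson
    have Nnull: "N \<in> null_sets lebesgue" using N by (simp add: negligible_iff_null_sets)
    then obtain U where U: "open U" "N \<subseteq> U" "emeasure lebesgue (U - N) < ennreal \<delta>"
      using sets_lebesgue_outer_open[OF null_setsD2[OF Nnull] \<open>\<delta> > 0\<close>] by metis
    have mU: "emeasure lebesgue U < ennreal \<delta>"
      using U(1,3) emeasure_Diff_null_set[OF Nnull, of U] by simp
    have "\<exists>r>0. (x \<in> N \<longrightarrow> ball x r \<subseteq> U) \<and> (x \<in> {a..b} - N \<longrightarrow>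
            (\<forall>y. \<bar>y - x\<bar> < r \<longrightarrow> \<bar>g y - g x - (y - x) * D x\<bar> \<le> e / 2 * \<bar>y - x\<bar>))" for x
    proof (cases "x \<in> N")
      case True
      then show ?thesis using U(1,2) open_contains_ball by auto
    next
      case False
      show ?thesis
      proof (cases "x \<in> {a..b}")
        case True
        have "(g has_derivative (\<lambda>y. y * D x)) (at x)"
          using D[of x] True False by (simp add: has_field_derivative_def mult_commute_abs)
        then obtain r where "r > 0" "\<forall>y. norm (y - x) < r \<longrightarrow>
            norm (g y - g x - (y - x) * D x) \<le> e / 2 * norm (y - x)"
          unfolding has_derivative_at_alt using half_gt_zero[OF \<open>e > 0\<close>] by blast
        then show ?thesis using False by auto
      qed (use False in \<open>auto intro: exI[of _ 1]\<close>)
    qed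
    then obtain r where r: "\<And>x. r x > 0" "\<And>x. x \<in> N \<Longrightarrow> ball x (r x) \<subseteq> U"
      "\<And>x y. x \<in> {a..b} - N \<Longrightarrow> \<bar>y - x\<bar> < r x \<Longrightarrow> \<bar>g y - g x - (y - x) * D x\<bar> \<le> e / 2 * \<bar>y - x\<bar>"
      by metis
    show "\<exists>d. gauge d \<and> (\<forall>p. p tagged_division_of {a..b} \<and> d fine p \<longrightarrow>
           norm ((\<Sum>(x, k)\<in>p. measure lborel k *\<^sub>R D x) - (g b - g a)) \<le> e * measure lborel {a..b})"
    proof (rule exI[of _ "\<lambda>x. ball x (r x)"], intro conjI allI impI)
      show "gauge (\<lambda>x. ball x (r x))" using r(1) gauge_ball_dependent by blast
      fix p assume p: "p tagged_division_of {a..b} \<and> (\<lambda>x. ball x (r x)) fine p"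
      then have tag: "p tagged_division_of {a..b}" and fine: "(\<lambda>x. ball x (r x)) fine p" by auto
      have fin: "finite p" using tag by auto
      have K: "K = {Inf K..Sup K} \<and> Inf K \<le> x \<and> x \<le> Sup K \<and> a \<le> Inf K \<and> Sup K \<le> b
           \<and> measure lborel K = Sup K - Inf K \<and> interior K = {Inf K<..<Sup K} \<and> K \<subseteq> ball x (r x)"
        if xK: "(x, K) \<in> p" for x K
      proof -
        obtain u v where uv: "K = cbox u v" "x \<in> K" "K \<subseteq> {a..b}"
          using tag xK by blast
        then have "u \<le> v" by auto
        then show ?thesis using uv fine xK by (auto simp: fine_def)
      qed
      have ba: "b - a = (\<Sum>(x,K)\<in>p. Sup K - Inf K)" "g b - g a = (\<Sum>(x,K)\<in>p. g (Sup K) - g (Inf K))"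
        using additive_tagged_division_1[where f= "\<lambda>x. x"] additive_tagged_division_1[where f= g]
            \<open>a \<le> b\<close> tag by auto
      define q where "q = {z \<in> p. fst z \<in> N}"
      have q: "q \<subseteq> p" "finite q" using fin by (auto simp: q_def)
      define E where "E = (\<lambda>(x, K). (Inf K, Sup K)) ` q"
      have disj: "interior K \<inter> interior K' = {}" if "(x, K) \<in> p" "(x', K') \<in> p" "(x, K) \<noteq> (x', K')" for x x' K K'
        using tag that by blast
      \<comment> \<open>Two members of \<open>q\<close> with the same interval but different tags have disjoint interiors, so the
        interval is a single point; but then both tags are that point.\<close>
      have inj: "inj_on (\<lambda>(x, K). (Inf K, Sup K :: real)) q"
      proof (rule inj_onI, clarify)
        fix x K x' K' assume *: "(x, K) \<in> q" "(x', K') \<in> q" and eq: "Inf K = Inf K'" "Sup K = Sup K'"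
        then have **: "(x, K) \<in> p" "(x', K') \<in> p" using q by auto
        have "K = K'" using K[OF **(1)] K[OF **(2)] eq by metis
        moreover have "x = x'"
        proof (rule ccontr)
          assume "x \<noteq> x'"
          then have "interior K = {}" using disj[OF **] \<open>K = K'\<close> by auto
          then have "{Inf K<..<Sup K} = {}" using K[OF **(1)] by blast
          then have "Inf K = Sup K" using K[OF **(1)] by (meson greaterThanLessThan_empty_iff order.antisym order.trans)
          then show False using K[OF **(1)] K[OF **(2)] eq \<open>x \<noteq> x'\<close> by linarith
        qed
        ultimately show "x = x' \<and> K = K'" by simp
      qed
      have djE: "disjoint_family_on (\<lambda>(u, v). {u<..<v}) E"
      proof (unfold disjoint_family_on_def, intro ballI impI)
        fix m n assume "m \<in> E" "n \<in> E" "m \<noteq> n"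
        obtain x K where 1: "(x, K) \<in> p" "m = (Inf K, Sup K)"
          using \<open>m \<in> E\<close> q(1) unfolding E_def by auto
        obtain x' K' where 2: "(x', K') \<in> p" "n = (Inf K', Sup K')"
          using \<open>n \<in> E\<close> q(1) unfolding E_def by auto
        have int: "interior K = {Inf K<..<Sup K}" "interior K' = {Inf K'<..<Sup K'}"
          using K[OF 1(1)] K[OF 2(1)] by blast+
        have "interior K \<inter> interior K' = {}"
          using disj[OF 1(1) 2(1)] 1 2 \<open>m \<noteq> n\<close> by blast
        then show "(case m of (u, v) \<Rightarrow> {u<..<v}) \<inter> (case n of (u, v) \<Rightarrow> {u<..<v}) = {}"
          unfolding int 1(2) 2(2) prod.case .
      qed
      have Eab: "a \<le> u \<and> u \<le> v \<and> v \<le> b \<and> {u<..<v} \<subseteq> U" if "(u, v) \<in> E" for u v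
      proof -
        obtain x K where xK: "(x, K) \<in> p" "x \<in> N" "u = Inf K" "v = Sup K"
          using \<open>(u, v) \<in> E\<close> q by (auto simp: E_def q_def)
        have "{u<..<v} \<subseteq> K"
          by (subst conjunct1[OF K[OF xK(1)]]) (auto simp: xK(3,4))
        moreover have "K \<subseteq> U" using K[OF xK(1)] r(2)[OF xK(2)] by blast
        ultimately show ?thesis using K[OF xK(1)] xK(3,4) by (metis order.trans)
      qed
      have "finite E" using q by (auto simp: E_def)
      have "(\<Sum>(u, v)\<in>E. v - u) = (\<Sum>z\<in>E. measure lebesgue (case z of (u, v) \<Rightarrow> {u<..<v}))"
        using Eab by (intro sum.cong) auto
      also have "\<dots> = measure lebesgue (\<Union>z\<in>E. case z of (u, v) \<Rightarrow> {u<..<v})"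
        using \<open>finite E\<close> djE by (intro measure_finite_Union[symmetric]) (auto dest: Eab)
      also have "\<dots> \<le> measure lebesgue U"
      proof (rule measure_mono_fmeasurable)
        show "(\<Union>z\<in>E. case z of (u, v) \<Rightarrow> {u<..<v}) \<in> sets lebesgue"
          using \<open>finite E\<close> by (intro sets.finite_UN) auto
        show "U \<in> lmeasurable"
          using mU U(1) by (intro fmeasurableI) (auto intro: order.strict_trans[OF _ ennreal_less_top])
      qed (use Eab in auto)
      also have "\<dots> < \<delta>"
        using mU \<open>\<delta> > 0\<close> by (metis emeasure_eq_ennreal_measure ennreal_less_iff measure_nonneg order.strict_trans ennreal_less_top less_irrefl top.not_eq_extremum)
      finally have "(\<Sum>(u, v)\<in>E. \<bar>g v - g u\<bar>) < e'"
        using \<open>finite E\<close> djE Eab by (intro \<delta>) auto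
      then have qsum: "(\<Sum>(x, K)\<in>q. \<bar>g (Sup K) - g (Inf K)\<bar>) < e'"
        unfolding E_def by (subst (asm) sum.reindex[OF inj]) (simp add: split_def)
      have q0: "\<bar>measure lborel K * D x - (g (Sup K) - g (Inf K))\<bar> = \<bar>g (Sup K) - g (Inf K)\<bar>" if "(x, K) \<in> q" for x K
        using that D0 by (simp add: q_def)
      have pq: "\<bar>measure lborel K * D x - (g (Sup K) - g (Inf K))\<bar> \<le> e / 2 * (Sup K - Inf K)" if "(x, K) \<in> p - q" for x K
      proof -
        have xK: "(x, K) \<in> p" "x \<notin> N" using that by (auto simp: q_def)
        note K' = K[OF xK(1)]
        have "Inf K \<in> K" "Sup K \<in> K" using K' atLeastAtMost_iff by (metis order.trans order_refl)+
        then have "\<bar>Inf K - x\<bar> < r x" "\<bar>Sup K - x\<bar> < r x"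
          using K' unfolding subset_iff mem_ball dist_real_def by (metis abs_minus_commute)+
        moreover have "x \<in> {a..b} - N" using K' xK(2) by (auto intro: order.trans)
        ultimately have "\<bar>g (Inf K) - g x - (Inf K - x) * D x\<bar> \<le> e / 2 * \<bar>Inf K - x\<bar>"
          "\<bar>g (Sup K) - g x - (Sup K - x) * D x\<bar> \<le> e / 2 * \<bar>Sup K - x\<bar>"
          using r(3)[of x] by blast+
        moreover have "measure lborel K * D x - (g (Sup K) - g (Inf K))
           = (g (Inf K) - g x - (Inf K - x) * D x) - (g (Sup K) - g x - (Sup K - x) * D x)"
        proof -
          have "measure lborel K = Sup K - Inf K" using K' by blast
          then show ?thesis by (simp only: left_diff_distrib)
        qed
        moreover have "e / 2 * \<bar>Inf K - x\<bar> + e / 2 * \<bar>Sup K - x\<bar> = e / 2 * (Sup K - Inf K)"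
        proof -
          have "\<bar>Inf K - x\<bar> + \<bar>Sup K - x\<bar> = Sup K - Inf K" using K' by linarith
          then show ?thesis by (metis distrib_left)
        qed
        ultimately show ?thesis by linarith
      qed
      have "norm ((\<Sum>(x, k)\<in>p. measure lborel k *\<^sub>R D x) - (g b - g a))
          = \<bar>\<Sum>(x, K)\<in>p. measure lborel K * D x - (g (Sup K) - g (Inf K))\<bar>"
        by (simp add: ba split_def sum_subtractf)
      also have "\<dots> \<le> (\<Sum>(x, K)\<in>p. \<bar>measure lborel K * D x - (g (Sup K) - g (Inf K))\<bar>)"
        by (simp add: split_def sum_abs)
      also have "\<dots> = (\<Sum>(x, K)\<in>p - q. \<bar>measure lborel K * D x - (g (Sup K) - g (Inf K))\<bar>)
            + (\<Sum>(x, K)\<in>q. \<bar>measure lborel K * D x - (g (Sup K) - g (Inf K))\<bar>)"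
        by (rule sum.subset_diff[OF q(1) fin])
      also have "\<dots> \<le> (\<Sum>(x, K)\<in>p - q. e / 2 * (Sup K - Inf K)) + (\<Sum>(x, K)\<in>q. \<bar>g (Sup K) - g (Inf K)\<bar>)"
        using pq q0 by (intro add_mono sum_mono) auto
      also have "(\<Sum>(x, K)\<in>p - q. e / 2 * (Sup K - Inf K)) \<le> (\<Sum>(x, K)\<in>p. e / 2 * (Sup K - Inf K))"
        proof (rule sum_mono2[OF fin], blast)
          fix z assume "z \<in> p - (p - q)"
          then have "Inf (snd z) \<le> Sup (snd z)" using K[of "fst z" "snd z"] by auto
          then show "0 \<le> (case z of (x, K) \<Rightarrow> e / 2 * (Sup K - Inf K))"
            using \<open>e > 0\<close> by (simp add: split_def)
        qed
      also have "\<dots> = e / 2 * (b - a)"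
        by (simp add: ba sum_distrib_left split_def)
      finally have "norm ((\<Sum>(x, k)\<in>p. measure lborel k *\<^sub>R D x) - (g b - g a))
          \<le> e / 2 * (b - a) + (\<Sum>(x, K)\<in>q. \<bar>g (Sup K) - g (Inf K)\<bar>)"
        by - linarith
      moreover have "e * measure lborel {a..b} = e / 2 * (b - a) + e'"
        using \<open>a \<le> b\<close> by (simp add: e'_def)
      ultimately show "norm ((\<Sum>(x, k)\<in>p. measure lborel k *\<^sub>R D x) - (g b - g a)) \<le> e * measure lborel {a..b}"
        using qsum by linarith
    qed
  qed
qed (use has_integral_refl in auto)

text \<open>
  The derivative is Lebesgue measurable because it is Henstock--Kurzweil integrable; so its
  Lebesgue integral exists as soon as it is dominated by an \<open>h\<close> of finite integral, and equals the
  increment.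
\<close>
corollary abs_continuous_increment_le:
  fixes g :: "real \<Rightarrow> real" and h :: "real \<Rightarrow> ennreal"
  assumes "a \<le> b" and ac: "abs_continuous a b g"
    and ae: "AE x in lborel. x \<in> {a<..<b} \<longrightarrow>
               (\<exists>D. (g has_real_derivative D) (at x) \<and> ennreal \<bar>D\<bar> \<le> h x)"
  shows "ennreal \<bar>g b - g a\<bar> \<le> (\<integral>\<^sup>+x\<in>{a..b}. h x \<partial>lborel)"
proof (cases "(\<integral>\<^sup>+x\<in>{a..b}. h x \<partial>lborel) = \<infinity>")
  case False
  \<comment> \<open>Endpoints are added to the exceptional set because the hypothesis speaks of the interior only.\<close>
  define Bad where "Bad = {x. x \<in> {a<..<b} \<and> \<not> (\<exists>D. (g has_real_derivative D) (at x) \<and> ennreal \<bar>D\<bar> \<le> h x)}"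
  define N where "N = Bad \<union> {a, b}"
  define D where "D x = (if x \<in> {a<..<b} - Bad then deriv g x else 0)" for x
  obtain N' where "N' \<in> null_sets lborel" "Bad \<subseteq> N'"
    using ae by (auto simp: eventually_ae_filter Bad_def)
  then have "negligible Bad"
    using negligible_iff_null_sets negligible_subset null_sets_completionI by metis
  then have "negligible N"
    by (auto simp: N_def intro: negligible_Un)
  have D: "(g has_real_derivative D x) (at x) \<and> ennreal \<bar>D x\<bar> \<le> h x" if "x \<in> {a<..<b} - Bad" for x
    using that by (auto simp: Bad_def D_def DERIV_imp_deriv)
  have "{a..b} - N \<subseteq> {a<..<b} - Bad" by (auto simp: N_def)
  then have hi: "(D has_integral (g b - g a)) {a..b}"
    using \<open>negligible N\<close> D
    by (intro abs_continuous_has_integral[OF assms(1,2)]) (blast, blast, auto simp: N_def D_def)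
  have nn: "(\<integral>\<^sup>+x. ennreal (norm (indicator {a..b} x *\<^sub>R D x)) \<partial>lebesgue) \<le> (\<integral>\<^sup>+x\<in>{a..b}. h x \<partial>lborel)"
    unfolding nn_integral_completion
    using D by (intro nn_integral_mono) (auto simp: indicator_def D_def)
  then have int: "integrable lebesgue (\<lambda>x. indicator {a..b} x *\<^sub>R D x)"
    using False has_integral_implies_lebesgue_measurable[OF hi]
    by (intro integrableI_bounded) (auto simp: less_top[symmetric] top_unique)
  then have "(D has_integral (LINT x:{a..b}|lebesgue. D x)) {a..b}"
    by (intro has_integral_set_lebesgue) (simp add: set_integrable_def)
  then have "g b - g a = (\<integral>x. indicator {a..b} x *\<^sub>R D x \<partial>lebesgue)"
    using has_integral_unique[OF hi] by (simp only: set_lebesgue_integral_def)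
  then have "ennreal \<bar>g b - g a\<bar> \<le> (\<integral>\<^sup>+x. ennreal (norm (indicator {a..b} x *\<^sub>R D x)) \<partial>lebesgue)"
    using integral_norm_bound_ennreal[OF int] by simp
  also note nn
  finally show ?thesis .
qed simp

section \<open>Taylor polynomials of jets\<close>

text \<open>
  The \<open>s\<close>-th derivative at \<open>y\<close> of the polynomial of degree at most \<open>k\<close> whose jet at \<open>0\<close> is
  \<open>u\<close>.  It is also the contribution of the left factor to the coordinate \<open>s\<close> of a product of jets.
\<close>
definition jet_taylor :: "nat \<Rightarrow> (nat \<Rightarrow> real) \<Rightarrow> nat \<Rightarrow> real \<Rightarrow> real" where
  "jet_taylor k u s y = (\<Sum>j=s..k. u j * (y ^ (j - s) / fact (j - s)))"

lemma jet_taylor_0: "jet_taylor k u s 0 = (if s \<le> k then u s else 0)"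
proof (cases "s \<le> k")
  case True
  then have "jet_taylor k u s 0 = u s + (\<Sum>j=Suc s..k. u j * (0 ^ (j - s) / fact (j - s)))"
    by (simp add: jet_taylor_def sum.atLeast_Suc_atMost)
  also have "(\<Sum>j=Suc s..k. u j * (0 ^ (j - s) / fact (j - s))) = 0"
    by (intro sum.neutral) auto
  finally show ?thesis using True by simp
qed (simp add: jet_taylor_def)

lemma has_derivative_jet_taylor:
  "(jet_taylor k u s has_real_derivative jet_taylor k u (Suc s) y) (at y)"
proof -
  have "((\<lambda>y. \<Sum>j=s..k. u j * (y ^ (j - s) / fact (j - s))) has_real_derivative
          (\<Sum>j=s..k. u j * (if j = s then 0 else y ^ (j - Suc s) / fact (j - Suc s)))) (at y)"
  proof (intro DERIV_sum DERIV_cmult)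
    fix j assume "j \<in> {s..k}"
    show "((\<lambda>y. y ^ (j - s) / fact (j - s)) has_real_derivative
            (if j = s then 0 else y ^ (j - Suc s) / fact (j - Suc s))) (at y)"
    proof (cases "j = s")
      case False
      define m where "m = j - Suc s"
      have m: "j - s = Suc m" using False \<open>j \<in> {s..k}\<close> by (auto simp: m_def)
      have "((\<lambda>y. y ^ Suc m / fact (Suc m)) has_real_derivative
          (1 + real m) * (1 * y ^ m) / fact (Suc m)) (at y)"
        by (rule DERIV_cdivide[OF DERIV_power_Suc[OF DERIV_ident]])
      also have "(1 + real m) * (1 * y ^ m) / fact (Suc m) = y ^ m / fact m"
        unfolding fact_Suc of_nat_Suc mult_1_left by (rule mult_divide_mult_cancel_left) simp
      finally have "((\<lambda>y. y ^ Suc m / fact (Suc m)) has_real_derivative y ^ m / fact m) (at y)" .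
      then show ?thesis using False by (simp only: m m_def[symmetric] if_False)
    qed simp
  qed
  also have "(\<Sum>j=s..k. u j * (if j = s then 0 else y ^ (j - Suc s) / fact (j - Suc s)))
      = jet_taylor k u (Suc s) y"
    unfolding jet_taylor_def by (rule sum.mono_neutral_cong_right) auto
  finally show ?thesis by (simp add: jet_taylor_def[abs_def])
qed

lemma abs_continuous_jet_taylor:
  assumes "abs_continuous a b f"
  shows "abs_continuous a b (\<lambda>\<tau>. jet_taylor k u s (f \<tau>))"
  unfolding jet_taylor_def times_divide_eq_right divide_inverse
  using assms
  by (intro abs_continuous_sum abs_continuous_mult abs_continuous_power abs_continuous_const)

lemma abs_continuous_poly:
  assumes "abs_continuous a b f"
  shows "abs_continuous a b (\<lambda>\<tau>. poly p (f \<tau>))"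
  unfolding poly_altdef
  using assms
  by (intro abs_continuous_sum abs_continuous_mult abs_continuous_power abs_continuous_const)

section \<open>Horizontal curves of small length move little vertically\<close>

lemma horizontal_velocity:
  assumes "v \<in> horizontal_space k p"
  obtains \<alpha> \<beta> where "fst v = \<alpha>" "\<And>s. s < k \<Longrightarrow> snd v s = \<alpha> * snd p (Suc s)" "snd v k = \<beta>"
  using assms by (auto simp: horizontal_space_def frame_X_def frame_U_def)

text \<open>
  The remainders \<open>P\<^sub>s\<close> are the coordinates of the curve after left translation of its starting
  point to the origin.  They start at \<open>0\<close> and satisfy \<open>P\<^sub>k' = u\<^sub>k'\<close> and \<open>P\<^sub>s' = x' P\<^sub>s\<^sub>+\<^sub>1\<close>, where
  \<open>\<bar>x'\<bar>\<close> and \<open>\<bar>u\<^sub>k'\<bar>\<close> are at most the speed.  Integrating from \<open>s = k\<close> downwards, each step gains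
  one factor \<open>l\<close>.
\<close>
lemma horizontal_curve_taylor_remainder:
  assumes hc: "horizontal_curve k a b \<gamma>" and "a \<le> b" "l > 0"
    and len: "horizontal_length k a b \<gamma> \<le> ennreal l"
    and "s \<le> k" "\<tau> \<in> {a..b}"
  shows "\<bar>snd (\<gamma> \<tau>) s - jet_taylor k (snd (\<gamma> a)) s (fst (\<gamma> \<tau>) - fst (\<gamma> a))\<bar> \<le> l ^ (k + 1 - s)"
proof -
  define P where "P s \<tau> = snd (\<gamma> \<tau>) s - jet_taylor k (snd (\<gamma> a)) s (fst (\<gamma> \<tau>) - fst (\<gamma> a))" for s \<tau>
  define h where "h \<tau> = sqrt ((deriv (\<lambda>\<sigma>. fst (\<gamma> \<sigma>)) \<tau>)\<^sup>2 + (deriv (\<lambda>\<sigma>. snd (\<gamma> \<sigma>) k) \<tau>)\<^sup>2)" for \<tau>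
  have Pa: "P s a = 0" if "s \<le> k" for s
    using that by (simp add: P_def jet_taylor_0)
  have acP: "abs_continuous a b (P s)" if "s \<le> k" for s
  proof -
    have x: "abs_continuous a b (\<lambda>\<tau>. fst (\<gamma> \<tau>) + (- fst (\<gamma> a)))"
      using hc by (intro abs_continuous_add abs_continuous_const) (simp add: horizontal_curve_def)
    have "abs_continuous a b (\<lambda>\<tau>. snd (\<gamma> \<tau>) s + (-1) * jet_taylor k (snd (\<gamma> a)) s (fst (\<gamma> \<tau>) + (- fst (\<gamma> a))))"
      using hc that
      by (intro abs_continuous_add abs_continuous_mult abs_continuous_const abs_continuous_jet_taylor x)
         (simp add: horizontal_curve_def)
    then show ?thesis by (simp add: P_def[abs_def])
  qed
  have ae: "AE \<tau> in lborel. \<tau> \<in> {a<..<b} \<longrightarrow> (\<exists>\<alpha> \<beta>. \<bar>\<alpha>\<bar> \<le> h \<tau> \<and> \<bar>\<beta>\<bar> \<le> h \<tau> \<and>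
        (\<forall>s<k. (P s has_real_derivative \<alpha> * P (Suc s) \<tau>) (at \<tau>)) \<and> (P k has_real_derivative \<beta>) (at \<tau>))"
  proof -
    have "AE \<tau> in lborel. \<tau> \<in> {a<..<b} \<longrightarrow> (\<exists>v\<in>horizontal_space k (\<gamma> \<tau>). jet_velocity \<gamma> \<tau> v)"
      using hc by (simp add: horizontal_curve_def)
    then show ?thesis
    proof (rule AE_mp, intro AE_I2 impI, goal_cases)
      case (1 \<tau>)
      then obtain v where v: "v \<in> horizontal_space k (\<gamma> \<tau>)" "jet_velocity \<gamma> \<tau> v" by blast
      obtain \<alpha> \<beta> where ab: "fst v = \<alpha>" "\<And>s. s < k \<Longrightarrow> snd v s = \<alpha> * snd (\<gamma> \<tau>) (Suc s)" "snd v k = \<beta>"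
        using horizontal_velocity[OF v(1)] by blast
      have dx: "((\<lambda>\<sigma>. fst (\<gamma> \<sigma>)) has_real_derivative \<alpha>) (at \<tau>)"
        and du: "\<And>s. ((\<lambda>\<sigma>. snd (\<gamma> \<sigma>) s) has_real_derivative snd v s) (at \<tau>)"
        using v(2) ab(1) by (auto simp: jet_velocity_def)
      have dP: "(P s has_real_derivative
             (snd v s - jet_taylor k (snd (\<gamma> a)) (Suc s) (fst (\<gamma> \<tau>) - fst (\<gamma> a)) * \<alpha>)) (at \<tau>)" for s
        unfolding P_def[abs_def]
        by (intro DERIV_diff du DERIV_chain2[OF has_derivative_jet_taylor])
           (use DERIV_diff[OF dx DERIV_const[of "fst (\<gamma> a)"]] in simp)
      have hh: "h \<tau> = sqrt (\<alpha>\<^sup>2 + \<beta>\<^sup>2)"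
        using DERIV_imp_deriv[OF dx] DERIV_imp_deriv[OF du[of k]] ab by (simp add: h_def)
      show ?case
      proof (rule exI[of _ \<alpha>], rule exI[of _ \<beta>], intro conjI allI impI)
        show "\<bar>\<alpha>\<bar> \<le> h \<tau>" "\<bar>\<beta>\<bar> \<le> h \<tau>"
          unfolding hh by (auto intro!: real_le_rsqrt)
        show "(P s has_real_derivative \<alpha> * P (Suc s) \<tau>) (at \<tau>)" if "s < k" for s
          using dP[of s] ab(2)[OF that] by (simp add: P_def algebra_simps)
        show "(P k has_real_derivative \<beta>) (at \<tau>)"
          using dP[of k] ab(3) by (simp add: jet_taylor_def)
      qed
    qed
  qed
  \<comment> \<open>Dividing \<open>P s\<close> by \<open>M\<close> first keeps the bare speed \<open>h\<close> under the integral, which avoids pulling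
    the constant out of the integral of a function not known to be measurable.\<close>
  have step: "\<bar>P s \<tau>\<bar> \<le> M * l"
    if "M > 0" "s \<le> k" and \<tau>: "\<tau> \<in> {a..b}"
      and D: "AE \<sigma> in lborel. \<sigma> \<in> {a<..<b} \<longrightarrow> (\<exists>D. (P s has_real_derivative D) (at \<sigma>) \<and> \<bar>D\<bar> \<le> M * h \<sigma>)"
    for s M \<tau>
  proof -
    have "ennreal \<bar>P s \<tau> / M - P s a / M\<bar> \<le> (\<integral>\<^sup>+\<sigma>\<in>{a..\<tau>}. ennreal (h \<sigma>) \<partial>lborel)"
    proof (rule abs_continuous_increment_le)
      show "abs_continuous a \<tau> (\<lambda>\<sigma>. P s \<sigma> / M)"
        unfolding divide_inverse
        using abs_continuous_subinterval[OF acP[OF \<open>s \<le> k\<close>], of a \<tau>] \<tau>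
        by (intro abs_continuous_mult abs_continuous_const) auto
      show "AE \<sigma> in lborel. \<sigma> \<in> {a<..<\<tau>} \<longrightarrow>
           (\<exists>D. ((\<lambda>\<sigma>. P s \<sigma> / M) has_real_derivative D) (at \<sigma>) \<and> ennreal \<bar>D\<bar> \<le> ennreal (h \<sigma>))"
        using D
      proof (rule AE_mp, intro AE_I2 impI, goal_cases)
        case (1 \<sigma>)
        then obtain D where D: "(P s has_real_derivative D) (at \<sigma>)" "\<bar>D\<bar> \<le> M * h \<sigma>" using \<tau> by auto
        then show ?case
          using \<open>M > 0\<close> by (intro exI[of _ "D / M"]) (auto intro!: ennreal_leI DERIV_cdivide simp: field_simps)
      qed
    qed (use \<tau> in auto)
    also have "\<dots> \<le> horizontal_length k a b \<gamma>"
      unfolding horizontal_length_def h_def using \<tau>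
      by (intro nn_integral_mono) (auto simp: indicator_def)
    also note len
    finally have "\<bar>P s \<tau>\<bar> / M \<le> l"
      using \<open>l > 0\<close> \<open>M > 0\<close> Pa[OF \<open>s \<le> k\<close>] by (simp add: ennreal_le_iff)
    then show ?thesis using \<open>M > 0\<close> by (simp add: field_simps)
  qed
  have "\<forall>\<tau>\<in>{a..b}. \<bar>P s \<tau>\<bar> \<le> l ^ (k + 1 - s)"
    using \<open>s \<le> k\<close>
  proof (induction rule: inc_induct)
    case base
    show ?case
    proof
      fix \<tau> assume "\<tau> \<in> {a..b}"
      then have "\<bar>P k \<tau>\<bar> \<le> 1 * l"
        by (intro step) (use ae in \<open>auto elim: eventually_mono\<close>)
      then show "\<bar>P k \<tau>\<bar> \<le> l ^ (k + 1 - k)" by simp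
    qed
  next
    case (step n)
    show ?case
    proof
      fix \<tau> assume "\<tau> \<in> {a..b}"
      have "\<bar>P n \<tau>\<bar> \<le> l ^ (k + 1 - Suc n) * l"
      proof (rule \<open>\<And>s M \<tau>. 0 < M \<Longrightarrow> s \<le> k \<Longrightarrow> _ \<Longrightarrow> _ \<Longrightarrow> \<bar>P s \<tau>\<bar> \<le> M * l\<close>)
        show "AE \<sigma> in lborel. \<sigma> \<in> {a<..<b} \<longrightarrow>
           (\<exists>D. (P n has_real_derivative D) (at \<sigma>) \<and> \<bar>D\<bar> \<le> l ^ (k + 1 - Suc n) * h \<sigma>)"
          using ae
        proof (rule AE_mp, intro AE_I2 impI, goal_cases)
          case (1 \<sigma>)
          then obtain \<alpha> where "\<bar>\<alpha>\<bar> \<le> h \<sigma>" "(P n has_real_derivative \<alpha> * P (Suc n) \<sigma>) (at \<sigma>)"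
            using \<open>n < k\<close> by blast
          moreover have "\<bar>\<alpha> * P (Suc n) \<sigma>\<bar> \<le> l ^ (k + 1 - Suc n) * h \<sigma>"
            unfolding abs_mult mult.commute[of "\<bar>\<alpha>\<bar>"] using step.IH 1 \<open>\<bar>\<alpha>\<bar> \<le> h \<sigma>\<close> \<open>l > 0\<close>
            by (intro mult_mono) auto
          ultimately show ?case by blast
        qed
      qed (use \<open>l > 0\<close> \<open>n < k\<close> \<open>\<tau> \<in> {a..b}\<close> in auto)
      also have "\<dots> = l ^ (k + 1 - n)"
        using \<open>n < k\<close> by (simp add: Suc_diff_le[symmetric] mult.commute flip: power_Suc)
      finally show "\<bar>P n \<tau>\<bar> \<le> l ^ (k + 1 - n)" .
    qed
  qed
  then show ?thesis using \<open>\<tau> \<in> {a..b}\<close> by (simp add: P_def)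
qed

text \<open>
  If the curve ends in the slice where it started, the Taylor polynomial is evaluated at \<open>0\<close>
  and the remainder is the displacement itself.
\<close>
lemma d_cc_vertical_lower_bound:
  assumes "fst p = fst q" "d_cc k p q \<le> ennreal D" "0 \<le> D" "s \<le> k"
  shows "\<bar>snd q s - snd p s\<bar> \<le> D ^ (k + 1 - s)"
proof -
  have *: "\<bar>snd q s - snd p s\<bar> \<le> l ^ (k + 1 - s)" if "l > D" for l
  proof -
    have "d_cc k p q < ennreal l"
      using assms that by (meson ennreal_lessI le_less_trans order.strict_trans1)
    then obtain a b \<gamma> where "horizontal_length k a b \<gamma> < ennreal l" "a \<le> b" "horizontal_curve k a b \<gamma>"
       "\<gamma> a = p" "\<gamma> b = q"
      unfolding d_cc_def Inf_less_iff by blast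
    then show ?thesis
      using horizontal_curve_taylor_remainder[of k a b \<gamma> l s b] assms that by (simp add: jet_taylor_0)
  qed
  have "((\<lambda>l. l ^ (k + 1 - s)) \<longlongrightarrow> D ^ (k + 1 - s)) (at_right D)"
    by (intro tendsto_intros)
  then show ?thesis
  proof (rule tendsto_lowerbound)
    show "\<forall>\<^sub>F l in at_right D. \<bar>snd q s - snd p s\<bar> \<le> l ^ (k + 1 - s)"
      using eventually_at_right_less[of D] by eventually_elim (rule *)
  qed simp
qed

section \<open>Connecting two points of a slice\<close>

lemma poly_higher_pderiv_root:
  fixes p :: "real poly"
  assumes "[:- a, 1:] ^ Suc k dvd p" "s \<le> k"
  shows "poly ((pderiv ^^ s) p) a = 0"
proof -
  have step: "[:- a, 1:] ^ n dvd pderiv q" if dvd: "[:- a, 1:] ^ Suc n dvd q" for n and q :: "real poly"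
  proof -
    obtain r where q: "q = [:- a, 1:] ^ Suc n * r" using dvd unfolding dvd_def by blast
    have "pderiv q = [:- a, 1:] ^ n * ([:- a, 1:] * pderiv r + r * smult (of_nat (Suc n)) (pderiv [:- a, 1:]))"
      unfolding q pderiv_mult pderiv_power_Suc by (simp add: algebra_simps)
    then show ?thesis by simp
  qed
  have "[:- a, 1:] ^ (Suc k - s) dvd (pderiv ^^ s) p"
    using \<open>s \<le> k\<close>
  proof (induction s)
    case (Suc s)
    then have "[:- a, 1:] ^ Suc (Suc k - Suc s) dvd (pderiv ^^ s) p"
      by (simp add: Suc_diff_le)
    from step[OF this] show ?case by simp
  qed (use assms in simp)
  then have "[:- a, 1:] dvd (pderiv ^^ s) p"
    using \<open>s \<le> k\<close> by (meson dvd_power dvd_trans zero_less_diff le_imp_less_Suc)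
  then show ?thesis by (simp add: poly_eq_0_iff_dvd)
qed

text \<open>
  Multiples of \<open>(X - 1) ^ (k + 1)\<close> have zero jet at \<open>1\<close>.  Among them the jet at \<open>0\<close>, i.e. the
  first \<open>k + 1\<close> coefficients, can be adjusted one coefficient at a time by adding multiples of
  \<open>X ^ n (X - 1) ^ (k + 1)\<close>, which leave the coefficients below \<open>n\<close> alone.
\<close>
lemma hermite_interpolation:
  fixes c :: "nat \<Rightarrow> real"
  shows "\<exists>H :: real poly. \<forall>s\<le>k. poly ((pderiv ^^ s) H) 0 = c s \<and> poly ((pderiv ^^ s) H) 1 = 0"
proof -
  let ?Q = "[:- 1, 1:] ^ Suc k :: real poly"
  have Q0: "coeff ?Q 0 \<noteq> 0"
    by (simp add: coeff_0_power)
  have "\<exists>H. ?Q dvd H \<and> (\<forall>s<n. coeff H s = c s / fact s)" for n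
  proof (induction n)
    case 0
    show ?case by (intro exI[of _ 0]) auto
  next
    case (Suc n)
    then obtain H where H: "?Q dvd H" "\<And>s. s < n \<Longrightarrow> coeff H s = c s / fact s" by blast
    define a where "a = (c n / fact n - coeff H n) / coeff ?Q 0"
    let ?H = "H + monom a n * ?Q"
    have "coeff ?H s = c s / fact s" if "s < Suc n" for s
      using that H(2)[of s] Q0
      by (cases "s = n") (auto simp: coeff_monom_mult a_def simp del: power_Suc)
    moreover have "?Q dvd ?H" using H(1) by (intro dvd_add dvd_triv_right)
    ultimately show ?case by blast
  qed
  then obtain H where H: "?Q dvd H" "\<And>s. s < Suc k \<Longrightarrow> coeff H s = c s / fact s" by blast
  have "poly ((pderiv ^^ s) H) 0 = c s \<and> poly ((pderiv ^^ s) H) 1 = 0" if "s \<le> k" for s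
    using H(2)[of s] poly_higher_pderiv_root[OF H(1) that] that
    by (simp add: poly_0_coeff_0 coeff_higher_pderiv pochhammer_fact[symmetric])
  then show ?thesis by blast
qed

text \<open>
  The interpolant can be chosen linear in the data, as a combination of the interpolants of the
  unit vectors; hence one bound serves all data of absolute value at most \<open>1\<close>.
\<close>
lemma hermite_interpolation_bounded:
  obtains C :: real where "C \<ge> 0"
    "\<And>c. (\<And>s. s \<le> k \<Longrightarrow> \<bar>c s\<bar> \<le> 1) \<Longrightarrow> \<exists>H :: real poly.
        (\<forall>s\<le>k. poly ((pderiv ^^ s) H) 0 = c s \<and> poly ((pderiv ^^ s) H) 1 = 0)
        \<and> (\<forall>y\<in>{0..1}. \<bar>poly ((pderiv ^^ Suc k) H) y\<bar> \<le> C)"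
proof -
  have "\<forall>i. \<exists>H :: real poly. \<forall>s\<le>k. poly ((pderiv ^^ s) H) 0 = (if s = i then 1 else 0)
      \<and> poly ((pderiv ^^ s) H) 1 = 0"
    using hermite_interpolation[of k "\<lambda>s. if s = i then 1 else 0" for i] by blast
  then obtain \<phi> :: "nat \<Rightarrow> real poly" where \<phi>:
    "\<And>i s. s \<le> k \<Longrightarrow> poly ((pderiv ^^ s) (\<phi> i)) 0 = (if s = i then 1 else 0)"
    "\<And>i s. s \<le> k \<Longrightarrow> poly ((pderiv ^^ s) (\<phi> i)) 1 = 0"
    by metis
  have "\<exists>B. \<forall>y\<in>{0..1}. \<bar>poly p y\<bar> \<le> B" for p :: "real poly"
  proof -
    have "bounded (poly p ` {0..1})"
      by (intro compact_imp_bounded compact_continuous_image continuous_intros) auto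
    then show ?thesis by (auto simp: bounded_iff)
  qed
  then have "\<forall>i. \<exists>B. \<forall>y\<in>{0..1}. \<bar>poly ((pderiv ^^ Suc k) (\<phi> i)) y\<bar> \<le> B"
    by blast
  then obtain B where B: "\<And>i y. y \<in> {0..1} \<Longrightarrow> \<bar>poly ((pderiv ^^ Suc k) (\<phi> i)) y\<bar> \<le> B i"
    by metis
  have B0: "0 \<le> B i" for i using B[of 0 i] by auto
  show ?thesis
  proof
    show "0 \<le> (\<Sum>i\<le>k. B i)" by (intro sum_nonneg B0)
    fix c :: "nat \<Rightarrow> real" assume c: "\<And>s. s \<le> k \<Longrightarrow> \<bar>c s\<bar> \<le> 1"
    define H where "H = (\<Sum>i\<le>k. smult (c i) (\<phi> i))"
    have H: "poly ((pderiv ^^ s) H) y = (\<Sum>i\<le>k. c i * poly ((pderiv ^^ s) (\<phi> i)) y)" for s y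
      by (simp add: H_def higher_pderiv_sum higher_pderiv_smult poly_sum)
    have "poly ((pderiv ^^ s) H) 0 = c s" "poly ((pderiv ^^ s) H) 1 = 0" if "s \<le> k" for s
      using that by (auto simp: H \<phi> if_distrib sum.delta cong: if_cong)
    moreover have "\<bar>poly ((pderiv ^^ Suc k) H) y\<bar> \<le> (\<Sum>i\<le>k. B i)" if "y \<in> {0..1}" for y
      unfolding H
    proof (rule order.trans[OF sum_abs], rule sum_mono)
      fix i assume "i \<in> {..k}"
      then show "\<bar>c i * poly ((pderiv ^^ Suc k) (\<phi> i)) y\<bar> \<le> B i"
        using mult_mono[OF c[of i] B[OF that, of i]] by (auto simp: abs_mult)
    qed
    ultimately show "\<exists>H. (\<forall>s\<le>k. poly ((pderiv ^^ s) H) 0 = c s \<and> poly ((pderiv ^^ s) H) 1 = 0)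
        \<and> (\<forall>y\<in>{0..1}. \<bar>poly ((pderiv ^^ Suc k) H) y\<bar> \<le> (\<Sum>i\<le>k. B i))"
      by blast
  qed
qed

text \<open>
  The curve goes from \<open>x = t\<close> to \<open>x = t + r\<close> along the jet of the Taylor polynomial of \<open>p\<close> and
  returns along the jet of that polynomial plus \<open>h\<close>, where \<open>h\<close> has jet \<open>q - p\<close> at \<open>t\<close> and jet \<open>0\<close> at
  \<open>t + r\<close>.  Along a jet \<open>u\<^sub>k'\<close> is the derivative of order \<open>k + 1\<close>, which vanishes for the Taylor
  polynomial.  For \<open>h (x) = r ^ (k + 1) H ((x - t) / r)\<close> it is that of \<open>H\<close>, and the assumption on
  \<open>q - p\<close> says exactly that the data of \<open>H\<close> have absolute value at most \<open>1\<close>.  So the speed is bounded, and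
  the length is a bounded multiple of \<open>r\<close>.
\<close>
lemma d_cc_vertical_upper_bound:
  obtains K :: real where "K > 0"
    "\<And>p q r. p \<in> jet_space k \<Longrightarrow> q \<in> jet_space k \<Longrightarrow> fst p = fst q \<Longrightarrow> r > 0 \<Longrightarrow>
       (\<And>s. s \<le> k \<Longrightarrow> \<bar>snd q s - snd p s\<bar> \<le> r ^ (k + 1 - s)) \<Longrightarrow> d_cc k p q \<le> ennreal (K * r)"
proof -
  obtain C :: real where C: "C \<ge> 0"
    "\<And>c. (\<And>s. s \<le> k \<Longrightarrow> \<bar>c s\<bar> \<le> 1) \<Longrightarrow> \<exists>H :: real poly.
        (\<forall>s\<le>k. poly ((pderiv ^^ s) H) 0 = c s \<and> poly ((pderiv ^^ s) H) 1 = 0)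
        \<and> (\<forall>y\<in>{0..1}. \<bar>poly ((pderiv ^^ Suc k) H) y\<bar> \<le> C)"
    using hermite_interpolation_bounded[of k] by blast
  show ?thesis
  proof
    show "2 * (1 + C) > 0" using C(1) by simp
    fix p q :: jet and r :: real
    assume p: "p \<in> jet_space k" and q: "q \<in> jet_space k" and pq: "fst p = fst q" and r: "r > 0"
      and w: "\<And>s. s \<le> k \<Longrightarrow> \<bar>snd q s - snd p s\<bar> \<le> r ^ (k + 1 - s)"
    define c where "c s = (snd q s - snd p s) / r ^ (k + 1 - s)" for s
    have "\<bar>c s\<bar> \<le> 1" if "s \<le> k" for s
      using w[OF that] r by (simp add: c_def abs_divide)
    from C(2)[of c, OF this] obtain H where H: "\<And>s. s \<le> k \<Longrightarrow> poly ((pderiv ^^ s) H) 0 = c s"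
      "\<And>s. s \<le> k \<Longrightarrow> poly ((pderiv ^^ s) H) 1 = 0"
      "\<And>y. y \<in> {0..1} \<Longrightarrow> \<bar>poly ((pderiv ^^ Suc k) H) y\<bar> \<le> C"
      by blast
    define T where "T = jet_taylor k (snd p)"
    \<comment> \<open>\<open>y\<close> is the argument of \<open>H\<close>.  It stays at \<open>1\<close>, where \<open>H\<close> has zero jet, on the way out
      (\<open>\<tau> \<le> 0\<close>) and runs from \<open>1\<close> to \<open>0\<close> on the way back, so that one formula covers both halves.\<close>
    define y where "y \<tau> = 1 - (\<tau> + \<bar>\<tau>\<bar>) / (2 * r)" for \<tau> :: real
    define \<gamma> :: "real \<Rightarrow> jet" where "\<gamma> \<tau> = (fst p + (r - \<bar>\<tau>\<bar>),
       \<lambda>s. if s \<le> k then T s (r - \<bar>\<tau>\<bar>) + r ^ (k + 1 - s) * poly ((pderiv ^^ s) H) (y \<tau>) else 0)" for \<tau>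
    have \<gamma>p: "\<gamma> (- r) = p"
      using p H(2) r by (auto simp: \<gamma>_def y_def T_def jet_taylor_0 prod_eq_iff fun_eq_iff jet_space_def)
    have \<gamma>q: "\<gamma> r = q"
      using q H(1) r pq
      by (auto simp: \<gamma>_def y_def T_def jet_taylor_0 prod_eq_iff fun_eq_iff jet_space_def c_def)
    have abs: "abs_continuous (- r) r (\<lambda>\<tau>. \<bar>\<tau>\<bar>)"
      by (rule lipschitz_imp_abs_continuous[of 1]) (auto simp: lipschitz_on_def dist_real_def)
    have id: "abs_continuous (- r) r (\<lambda>\<tau>. \<tau>)"
      by (rule lipschitz_imp_abs_continuous[of 1]) (auto simp: lipschitz_on_def)
    have acx: "abs_continuous (- r) r (\<lambda>\<tau>. r - \<bar>\<tau>\<bar>)"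
      using abs_continuous_add[OF abs_continuous_const[of _ _ r] abs_continuous_mult[OF abs_continuous_const[of _ _ "-1"] abs]]
      by simp
    have acy: "abs_continuous (- r) r y"
      using abs_continuous_add[OF abs_continuous_const[of _ _ 1]
          abs_continuous_mult[OF abs_continuous_const[of _ _ "-1 / (2 * r)"] abs_continuous_add[OF id abs]]]
      by (simp add: y_def[abs_def])
    define \<beta> where "\<beta> \<tau> = r * (poly ((pderiv ^^ Suc k) H) (y \<tau>) * - ((1 + sgn \<tau>) / (2 * r)))" for \<tau>
    define V :: "real \<Rightarrow> jet" where "V \<tau> = (- sgn \<tau>,
       \<lambda>s. if s < k then - sgn \<tau> * snd (\<gamma> \<tau>) (Suc s) else if s = k then \<beta> \<tau> else 0)" for \<tau>
    have V: "V \<tau> \<in> horizontal_space k (\<gamma> \<tau>)" for \<tau>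
      unfolding horizontal_space_def frame_X_def frame_U_def V_def
      by (intro CollectI exI[of _ "- sgn \<tau>"] exI[of _ "\<beta> \<tau>"]) (auto simp: fun_eq_iff)
    have vel: "jet_velocity \<gamma> \<tau> (V \<tau>)" if "\<tau> \<noteq> 0" for \<tau>
    proof -
      have dabs: "((\<lambda>\<tau>. \<bar>\<tau>\<bar>) has_real_derivative sgn \<tau>) (at \<tau>)"
      proof (rule has_field_derivative_transform_within)
        show "((\<lambda>\<sigma>. sgn \<tau> * \<sigma>) has_real_derivative sgn \<tau>) (at \<tau>)"
          using DERIV_cmult[OF DERIV_ident, of "sgn \<tau>"] by simp
        show "sgn \<tau> * \<sigma> = \<bar>\<sigma>\<bar>" if "dist \<sigma> \<tau> < \<bar>\<tau>\<bar>" for \<sigma>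
          using that by (cases "\<tau> > 0") (auto simp: dist_real_def)
      qed (use that in auto)
      have dx: "((\<lambda>\<tau>. r - \<bar>\<tau>\<bar>) has_real_derivative - sgn \<tau>) (at \<tau>)"
        using DERIV_diff[OF DERIV_const dabs] by simp
      have dy: "(y has_real_derivative - ((1 + sgn \<tau>) / (2 * r))) (at \<tau>)"
        using DERIV_diff[OF DERIV_const DERIV_cdivide[OF DERIV_add[OF DERIV_ident dabs]], of 1 "2 * r"]
        by (simp add: y_def[abs_def])
      have dT: "((\<lambda>\<tau>. T s (r - \<bar>\<tau>\<bar>)) has_real_derivative T (Suc s) (r - \<bar>\<tau>\<bar>) * (- sgn \<tau>)) (at \<tau>)" for s
        unfolding T_def by (rule DERIV_chain2[OF has_derivative_jet_taylor dx])
      have dH: "((\<lambda>\<tau>. poly ((pderiv ^^ s) H) (y \<tau>)) has_real_derivative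
           poly ((pderiv ^^ Suc s) H) (y \<tau>) * - ((1 + sgn \<tau>) / (2 * r))) (at \<tau>)" for s
        unfolding funpow.simps o_apply by (rule DERIV_chain2[OF poly_DERIV dy])
      have "((\<lambda>\<tau>. snd (\<gamma> \<tau>) s) has_real_derivative snd (V \<tau>) s) (at \<tau>)" for s
      proof (cases "s \<le> k")
        case True
        have "((\<lambda>\<tau>. T s (r - \<bar>\<tau>\<bar>) + r ^ (k + 1 - s) * poly ((pderiv ^^ s) H) (y \<tau>)) has_real_derivative
           T (Suc s) (r - \<bar>\<tau>\<bar>) * (- sgn \<tau>)
           + r ^ (k + 1 - s) * (poly ((pderiv ^^ Suc s) H) (y \<tau>) * - ((1 + sgn \<tau>) / (2 * r)))) (at \<tau>)"
          by (intro DERIV_add DERIV_cmult dT dH)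
        also have "T (Suc s) (r - \<bar>\<tau>\<bar>) * (- sgn \<tau>)
           + r ^ (k + 1 - s) * (poly ((pderiv ^^ Suc s) H) (y \<tau>) * - ((1 + sgn \<tau>) / (2 * r))) = snd (V \<tau>) s"
        proof (cases "s < k")
          case True
          then have rs: "r ^ (k + 1 - s) = r * r ^ (k + 1 - Suc s)"
            by (simp add: Suc_diff_le flip: power_Suc)
          have "poly ((pderiv ^^ Suc s) H) (y \<tau>) * (1 + sgn \<tau>) = 2 * sgn \<tau> * poly ((pderiv ^^ Suc s) H) (y \<tau>)"
          proof (cases "\<tau> > 0")
            case False
            then have "y \<tau> = 1" by (simp add: y_def)
            then show ?thesis using H(2)[of "Suc s"] True by simp
          qed simp
          then have "r ^ (k + 1 - s) * (poly ((pderiv ^^ Suc s) H) (y \<tau>) * - ((1 + sgn \<tau>) / (2 * r)))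
             = - sgn \<tau> * (r ^ (k + 1 - Suc s) * poly ((pderiv ^^ Suc s) H) (y \<tau>))"
            unfolding rs using r by (simp add: field_simps)
          then show ?thesis using True
            by (simp add: V_def \<gamma>_def algebra_simps del: funpow.simps)
        next
          case False
          with \<open>s \<le> k\<close> have "s = k" by simp
          then show ?thesis by (simp add: V_def \<beta>_def T_def jet_taylor_def del: funpow.simps)
        qed
        finally show ?thesis using True by (simp add: \<gamma>_def)
      qed (simp add: \<gamma>_def V_def)
      moreover have "((\<lambda>\<tau>. fst (\<gamma> \<tau>)) has_real_derivative fst (V \<tau>)) (at \<tau>)"
        using DERIV_add[OF DERIV_const dx] by (simp add: \<gamma>_def V_def)
      ultimately show ?thesis by (simp add: jet_velocity_def)
    qed
    have ae: "AE \<tau> in lborel. \<tau> \<noteq> (0::real)"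
      by (rule AE_lborel_singleton)
    have "horizontal_curve k (- r) r \<gamma>"
      unfolding horizontal_curve_def
    proof (intro conjI allI impI)
      show "\<gamma> ` {- r..r} \<subseteq> jet_space k" by (auto simp: \<gamma>_def jet_space_def)
      show "abs_continuous (- r) r (\<lambda>\<tau>. fst (\<gamma> \<tau>))"
        unfolding \<gamma>_def fst_conv by (intro abs_continuous_add abs_continuous_const acx)
      show "abs_continuous (- r) r (\<lambda>\<tau>. snd (\<gamma> \<tau>) s)" if "s \<le> k" for s
        using that unfolding \<gamma>_def snd_conv T_def
        by (simp, intro abs_continuous_add abs_continuous_mult abs_continuous_const acx
              abs_continuous_jet_taylor abs_continuous_poly acy)
      show "AE \<tau> in lborel. \<tau> \<in> {- r<..<r} \<longrightarrow> (\<exists>v\<in>horizontal_space k (\<gamma> \<tau>). jet_velocity \<gamma> \<tau> v)"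
        using ae by eventually_elim (use V vel in blast)
    qed
    then have "d_cc k p q \<le> horizontal_length k (- r) r \<gamma>"
      unfolding d_cc_def
      by (intro Inf_lower CollectI exI[of _ "- r"] exI[of _ r] exI[of _ \<gamma>])
         (use \<gamma>p \<gamma>q r in auto)
    also have "\<dots> \<le> (\<integral>\<^sup>+\<tau>\<in>{- r..r}. ennreal (1 + C) \<partial>lborel)"
      unfolding horizontal_length_def
    proof (rule nn_integral_mono_AE)
      show "AE \<tau> in lborel. ennreal (sqrt ((deriv (\<lambda>\<sigma>. fst (\<gamma> \<sigma>)) \<tau>)\<^sup>2 + (deriv (\<lambda>\<sigma>. snd (\<gamma> \<sigma>) k) \<tau>)\<^sup>2))
              * indicator {- r..r} \<tau> \<le> ennreal (1 + C) * indicator {- r..r} \<tau>"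
        using ae
      proof eventually_elim
        case (elim \<tau>)
        have dx: "deriv (\<lambda>\<sigma>. fst (\<gamma> \<sigma>)) \<tau> = - sgn \<tau>" and du: "deriv (\<lambda>\<sigma>. snd (\<gamma> \<sigma>) k) \<tau> = \<beta> \<tau>"
          using vel[OF elim] by (auto simp: jet_velocity_def V_def intro!: DERIV_imp_deriv dest: spec[of _ k])
        have "sqrt ((- sgn \<tau>)\<^sup>2 + (\<beta> \<tau>)\<^sup>2) \<le> 1 + C" if "\<tau> \<in> {- r..r}"
        proof -
          have "y \<tau> \<in> {0..1}" using that r by (auto simp: y_def abs_if field_simps)
          then have "\<bar>poly ((pderiv ^^ Suc k) H) (y \<tau>)\<bar> \<le> C" by (rule H(3))
          moreover have "\<bar>\<beta> \<tau>\<bar> = \<bar>poly ((pderiv ^^ Suc k) H) (y \<tau>)\<bar> * ((1 + sgn \<tau>) / 2)"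
            using r by (simp add: \<beta>_def abs_mult abs_divide sgn_if del: funpow.simps)
          ultimately have "\<bar>\<beta> \<tau>\<bar> \<le> C"
            using C(1) by (cases "\<tau> > 0") (auto simp: sgn_if elim simp del: funpow.simps)
          moreover have "\<bar>- sgn \<tau>\<bar> \<le> 1" by (simp add: sgn_if)
          ultimately show ?thesis
            using sqrt_sum_squares_le_sum_abs[of "- sgn \<tau>" "\<beta> \<tau>"] by linarith
        qed
        then show ?case unfolding dx du by (auto simp: indicator_def intro!: ennreal_leI)
      qed
    qed
    also have "\<dots> = ennreal (1 + C) * emeasure lborel {- r..r}"
      by (rule nn_integral_cmult_indicator) simp
    also have "\<dots> = ennreal (2 * (1 + C) * r)"
      using r C(1) by (simp add: ennreal_mult[symmetric] algebra_simps)
    finally show "d_cc k p q \<le> ennreal (2 * (1 + C) * r)" .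
  qed
qed

lemma d_cc_refl:
  assumes "p \<in> jet_space k"
  shows "d_cc k p p = 0"
proof -
  obtain K :: real where K: "K > 0"
    "\<And>p q r. p \<in> jet_space k \<Longrightarrow> q \<in> jet_space k \<Longrightarrow> fst p = fst q \<Longrightarrow> r > 0 \<Longrightarrow>
       (\<And>s. s \<le> k \<Longrightarrow> \<bar>snd q s - snd p s\<bar> \<le> r ^ (k + 1 - s)) \<Longrightarrow> d_cc k p q \<le> ennreal (K * r)"
    using d_cc_vertical_upper_bound[of k] by blast
  have "d_cc k p p \<le> 0"
  proof (rule ennreal_le_epsilon)
    fix e :: real assume "0 < e"
    then show "d_cc k p p \<le> 0 + ennreal e"
      using K(2)[of p p "e / K"] K(1) assms by simp
  qed
  then show ?thesis by simp
qed

section \<open>Coding a Cantor set by the unit interval\<close>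

lemma power_powr_swap: "((x :: real) ^ n) powr a = (x powr a) ^ n"
  by (induction n) (simp_all add: powr_mult)

text \<open>
  Used for the differences of two digit sequences, whose entries are \<open>-1\<close>, \<open>0\<close> or \<open>1\<close>.
\<close>
lemma signed_series_bound:
  fixes e :: "nat \<Rightarrow> real" and l :: real
  assumes "0 < l" "l < 1" and e: "\<And>i. \<bar>e i\<bar> \<le> 1" and e0: "\<And>i. i < n \<Longrightarrow> e i = 0"
  shows "summable (\<lambda>i. e i * l ^ i)" "\<bar>\<Sum>i. e i * l ^ i\<bar> \<le> l ^ n / (1 - l)"
proof -
  let ?f = "\<lambda>i. if i < n then 0 else l ^ i"
  have "(\<lambda>i. l ^ n * l ^ i) sums (l ^ n * (1 / (1 - l)))"
    using assms(1,2) by (intro sums_mult geometric_sums) auto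
  then have "(\<lambda>i. ?f (i + n)) sums (l ^ n / (1 - l))"
    by (simp add: power_add mult.commute)
  then have f: "?f sums (l ^ n / (1 - l))"
    by (subst (asm) sums_zero_iff_shift) auto
  have le: "norm (e i * l ^ i) \<le> ?f i" for i
    using e[of i] e0[of i] \<open>0 < l\<close> by (auto simp: abs_mult mult_left_le_one_le)
  show "summable (\<lambda>i. e i * l ^ i)"
    by (rule summable_comparison_test'[OF sums_summable[OF f]]) (rule le)
  show "\<bar>\<Sum>i. e i * l ^ i\<bar> \<le> l ^ n / (1 - l)"
    using norm_suminf_le[OF le sums_summable[OF f]] sums_unique[OF f] by simp
qed

lemma binary_cell_diameter:
  fixes x y :: real
  assumes "\<lfloor>2 ^ m * x\<rfloor> = \<lfloor>2 ^ m * y\<rfloor>"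
  shows "\<bar>x - y\<bar> \<le> (1 / 2) ^ m"
proof -
  have "\<bar>2 ^ m * x - 2 ^ m * y\<bar> < 1" using assms by linarith
  then have "2 ^ m * \<bar>x - y\<bar> < 1" by (simp add: abs_mult flip: right_diff_distrib)
  then show ?thesis by (simp add: field_simps power_one_over)
qed

lemma floor_power2_coarsen:
  fixes x :: real
  assumes "i \<le> m"
  shows "\<lfloor>2 ^ i * x\<rfloor> = \<lfloor>2 ^ m * x\<rfloor> div 2 ^ (m - i)"
proof -
  have "(2 :: real) ^ m = 2 ^ i * 2 ^ (m - i)" using assms by (simp flip: power_add)
  then have "2 ^ i * x = 2 ^ m * x / real_of_int (2 ^ (m - i))" by simp
  then show ?thesis by (metis floor_divide_real_eq_div zero_le_numeral zero_le_power)
qed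

text \<open>
  The model is \<open>G (x) = \<Sum>i. b\<^sub>i \<lambda> ^ i\<close> with \<open>b\<^sub>i\<close> the binary digits of \<open>x\<close> and
  \<open>\<lambda> powr \<theta> = 1 / 2\<close>, which maps \<open>[0, 1)\<close> into a Cantor set of dimension \<open>\<theta>\<close>.  The first condition
  says that the inverse of \<open>G\<close> is \<open>\<theta>\<close>-Hoelder (it is the Cantor function), the second that
  dyadic intervals of level \<open>m\<close> have images of diameter at most of order \<open>\<lambda> ^ m\<close>.
\<close>
definition cantor_coding :: "real \<Rightarrow> real \<Rightarrow> (real \<Rightarrow> real) \<Rightarrow> bool" where
  "cantor_coding \<theta> K G \<longleftrightarrow> K \<ge> 1 \<and> (\<forall>x\<in>{0..<1}. \<forall>y\<in>{0..<1}.
      \<bar>x - y\<bar> \<le> K * \<bar>G x - G y\<bar> powr \<theta> \<and>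
      (\<forall>m. \<lfloor>2 ^ m * x\<rfloor> = \<lfloor>2 ^ m * y\<rfloor> \<longrightarrow> \<bar>G x - G y\<bar> \<le> K * (2 powr (- 1 / \<theta>)) ^ m))"

text \<open>
  For \<open>\<theta> < 1\<close> one has \<open>\<lambda> < 1 / 2\<close>, so there is a gap: if \<open>n\<close> is the first digit in which \<open>x\<close> and
  \<open>y\<close> differ, that digit contributes \<open>\<lambda> ^ n\<close> to \<open>G x - G y\<close> and the later ones cannot cancel it.
  For \<open>\<theta> = 1\<close> the gap closes and the identity is taken instead.
\<close>
lemma cantor_coding_exists:
  fixes \<theta> :: real
  assumes "0 < \<theta>" "\<theta> \<le> 1"
  shows "\<exists>K G. cantor_coding \<theta> K G"
proof (cases "\<theta> = 1")
  case True
  have "\<bar>x - y\<bar> \<le> (2 powr (- 1 / \<theta>)) ^ m" if "\<lfloor>2 ^ m * x\<rfloor> = \<lfloor>2 ^ m * y\<rfloor>" for x y :: real and m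
    using binary_cell_diameter[OF that] True by (simp add: powr_minus_divide)
  then have "cantor_coding \<theta> 1 (\<lambda>x. x)"
    using True by (simp add: cantor_coding_def)
  then show ?thesis by blast
next
  case False
  define l where "l = 2 powr (- 1 / \<theta>)"
  have l: "0 < l" "l < 1 / 2"
  proof -
    have "- 1 / \<theta> < - 1" using assms False by (simp add: field_simps)
    then have "l < 2 powr (- 1)" unfolding l_def by (intro powr_less_mono) auto
    then show "l < 1 / 2" by (simp add: powr_minus_divide)
  qed (simp add: l_def)
  define dig :: "real \<Rightarrow> nat \<Rightarrow> real" where "dig x i = of_int (\<lfloor>2 ^ Suc i * x\<rfloor> mod 2)" for x i
  define G where "G x = (\<Sum>i. dig x i * l ^ i)" for x
  \<comment> \<open>\<open>g\<close> is the relative size of the gap: \<open>1\<close> minus the largest possible tail.\<close>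
  define g where "g = 1 - l / (1 - l)"
  have "g > 0" using l by (simp add: g_def field_simps)
  have dig01: "dig x i \<in> {0, 1}" for x i
    by (auto simp: dig_def)
  have "\<bar>dig x i\<bar> \<le> 1" for x i
    using dig01[of x i] by auto
  then have summ: "summable (\<lambda>i. dig x i * l ^ i)" for x
    by (intro signed_series_bound(1)[of l _ 0]) (use l in auto)
  have Gdiff: "G x - G y = (\<Sum>i. (dig x i - dig y i) * l ^ i)" for x y
    unfolding G_def left_diff_distrib by (rule suminf_diff[OF summ summ])
  have dig1: "\<bar>dig x i - dig y i\<bar> \<le> 1" for x y i
    using dig01[of x i] dig01[of y i] by auto
  have dig_eq: "dig x i = dig y i" if "\<lfloor>2 ^ m * x\<rfloor> = \<lfloor>2 ^ m * y\<rfloor>" "i < m" for x y m i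
    using that floor_power2_coarsen[of "Suc i" m x] floor_power2_coarsen[of "Suc i" m y]
    by (simp add: dig_def del: power_Suc)
  have cell: "\<bar>G x - G y\<bar> \<le> 2 * l ^ m" if "\<lfloor>2 ^ m * x\<rfloor> = \<lfloor>2 ^ m * y\<rfloor>" for x y m
  proof -
    have "\<bar>G x - G y\<bar> \<le> l ^ m / (1 - l)"
      unfolding Gdiff using l dig1 dig_eq[OF that] by (intro signed_series_bound) auto
    also have "\<dots> \<le> l ^ m / (1 / 2)"
      using l by (intro divide_left_mono) auto
    finally show ?thesis by simp
  qed
  have hoelder: "\<bar>x - y\<bar> \<le> (1 / g powr \<theta>) * \<bar>G x - G y\<bar> powr \<theta>"
    if xy: "x \<in> {0..<1}" "y \<in> {0..<1}" for x y
  proof (cases "x = y")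
    case False
    obtain m where "(1 / 2 :: real) ^ m < \<bar>x - y\<bar>"
      using real_arch_pow_inv[of "\<bar>x - y\<bar>" "1 / 2"] False by auto
    then have "\<lfloor>2 ^ m * x\<rfloor> \<noteq> \<lfloor>2 ^ m * y\<rfloor>"
      using binary_cell_diameter[of m x y] by force
    then obtain n where n: "\<lfloor>2 ^ n * x\<rfloor> = \<lfloor>2 ^ n * y\<rfloor>" "\<lfloor>2 ^ Suc n * x\<rfloor> \<noteq> \<lfloor>2 ^ Suc n * y\<rfloor>"
    proof (induction m arbitrary: thesis)
      case 0
      have "\<lfloor>x\<rfloor> = 0" "\<lfloor>y\<rfloor> = 0" using xy by (auto simp: floor_eq_iff)
      then show ?case using 0 by simp
    qed blast
    define e where "e i = dig x i - dig y i" for i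
    \<comment> \<open>Splitting off the term of index \<open>n\<close> leaves a series that starts at \<open>n + 1\<close>.\<close>
    define e' where "e' = e(n := 0)"
    have en: "\<bar>e n\<bar> = 1"
    proof -
      have "\<lfloor>2 ^ Suc n * x\<rfloor> div 2 = \<lfloor>2 ^ Suc n * y\<rfloor> div 2"
        using floor_power2_coarsen[of n "Suc n" x] floor_power2_coarsen[of n "Suc n" y] n(1) by simp
      then have "dig x n \<noteq> dig y n"
        using n(2) unfolding dig_def of_int_eq_iff by (metis mult_div_mod_eq)
      then show ?thesis using dig01[of x n] dig01[of y n] by (auto simp: e_def)
    qed
    have e': "summable (\<lambda>i. e' i * l ^ i)" "\<bar>\<Sum>i. e' i * l ^ i\<bar> \<le> l ^ Suc n / (1 - l)"
      by (rule signed_series_bound; use l dig1 dig_eq[OF n(1)] in \<open>auto simp: e'_def e_def less_Suc_eq\<close>)+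
    have "(\<lambda>i. e' i * l ^ i + (if i = n then e n * l ^ n else 0)) sums ((\<Sum>i. e' i * l ^ i) + e n * l ^ n)"
      by (intro sums_add summable_sums e') (rule sums_single)
    moreover have "(\<lambda>i. e' i * l ^ i + (if i = n then e n * l ^ n else 0)) = (\<lambda>i. e i * l ^ i)"
      by (auto simp: e'_def)
    ultimately have "G x - G y = (\<Sum>i. e' i * l ^ i) + e n * l ^ n"
      unfolding Gdiff e_def[symmetric] by (simp add: sums_iff)
    moreover have "\<bar>e n * l ^ n\<bar> = l ^ n" using en l by (simp add: abs_mult)
    ultimately have "\<bar>G x - G y\<bar> \<ge> l ^ n - l ^ Suc n / (1 - l)"
      using e'(2) by linarith
    then have "l ^ n * g \<le> \<bar>G x - G y\<bar>"
      by (simp add: g_def algebra_simps)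
    then have "(l ^ n * g) powr \<theta> \<le> \<bar>G x - G y\<bar> powr \<theta>"
      using l \<open>g > 0\<close> assms by (intro powr_mono2) auto
    moreover have "(l ^ n) powr \<theta> = (1 / 2) ^ n"
    proof -
      have "(l ^ n) powr \<theta> = (l powr \<theta>) ^ n"
        by (rule power_powr_swap)
      also have "l powr \<theta> = 1 / 2" using assms
      proof -
        have "- 1 / \<theta> * \<theta> = - 1" using assms by simp
        then show ?thesis unfolding l_def powr_powr by (simp add: powr_minus_divide)
      qed
      finally show ?thesis .
    qed
    ultimately have "(1 / 2) ^ n * g powr \<theta> \<le> \<bar>G x - G y\<bar> powr \<theta>"
      by (simp only: powr_mult)
    moreover have "g powr \<theta> > 0" using \<open>g > 0\<close> by simp
    ultimately have "(1 / 2) ^ n \<le> (1 / g powr \<theta>) * \<bar>G x - G y\<bar> powr \<theta>"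
      by (simp only: mult_1_left times_divide_eq_left pos_le_divide_eq)
    then show ?thesis using binary_cell_diameter[OF n(1)] by linarith
  qed simp
  let ?K = "max 2 (1 / g powr \<theta>)"
  have "\<bar>x - y\<bar> \<le> ?K * \<bar>G x - G y\<bar> powr \<theta>" if "x \<in> {0..<1}" "y \<in> {0..<1}" for x y
    by (rule order.trans[OF hoelder[OF that] mult_right_mono]) auto
  moreover have "\<bar>G x - G y\<bar> \<le> ?K * (2 powr (- 1 / \<theta>)) ^ m"
    if "\<lfloor>2 ^ m * x\<rfloor> = \<lfloor>2 ^ m * y\<rfloor>" for x y m
    using l unfolding l_def[symmetric] by (intro order.trans[OF cell[OF that] mult_right_mono]) auto
  ultimately have "cantor_coding \<theta> ?K G"
    unfolding cantor_coding_def by (intro conjI ballI allI impI) auto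
  then show ?thesis by blast
qed

section \<open>Estimating the Hausdorff dimension\<close>

lemma ediam_least:
  assumes "\<And>p q. p \<in> A \<Longrightarrow> q \<in> A \<Longrightarrow> d p q \<le> r"
  shows "ediam d A \<le> r"
  unfolding ediam_def using assms by (intro SUP_least) auto

lemma le_ediam:
  assumes "p \<in> A" "q \<in> A"
  shows "d p q \<le> ediam d A"
  unfolding ediam_def using assms by (meson SUP_upper SUP_upper2)

text \<open>
  Finite covers by sets of a common scale \<open>r\<close> are enough here; they are padded with empty sets,
  for which the term of the sum is \<open>0\<close> for every exponent.
\<close>
lemma hausdorff_measure_eq_0I:
  fixes M :: "'a set" and d :: "'a \<Rightarrow> 'a \<Rightarrow> ennreal"
  assumes "s > 0"
    and cover: "\<And>\<delta>. \<delta> > 0 \<Longrightarrow> \<exists>(J :: 'i set) B r. finite J \<and> 0 \<le> r \<and> r \<le> \<delta>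
        \<and> (\<forall>j\<in>J. B j \<subseteq> M \<and> ediam d (B j) \<le> ennreal r) \<and> A \<subseteq> (\<Union>j\<in>J. B j)
        \<and> real (card J) * r powr s \<le> \<delta>"
  shows "hausdorff_measure M d s A = 0"
proof -
  have le: "hausdorff_premeasure M d s \<delta> A \<le> 0 + ennreal \<epsilon>" if "\<delta> > 0" "\<epsilon> > 0" for \<delta> \<epsilon>
  proof -
    have "min \<delta> \<epsilon> > 0" using that by simp
    from cover[OF this] obtain J :: "'i set" and B r where *: "finite J \<and> 0 \<le> r \<and> r \<le> min \<delta> \<epsilon>
        \<and> (\<forall>j\<in>J. B j \<subseteq> M \<and> ediam d (B j) \<le> ennreal r) \<and> A \<subseteq> (\<Union>j\<in>J. B j)
        \<and> real (card J) * r powr s \<le> min \<delta> \<epsilon>"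
      by blast
    then have J: "finite J" and r: "0 \<le> r" "r \<le> \<delta>"
      and B: "\<And>j. j \<in> J \<Longrightarrow> B j \<subseteq> M" "\<And>j. j \<in> J \<Longrightarrow> ediam d (B j) \<le> ennreal r" "A \<subseteq> (\<Union>j\<in>J. B j)"
      and small: "real (card J) * r powr s \<le> \<epsilon>"
      by auto
    obtain h where h: "bij_betw h {..<card J} J"
      using ex_bij_betw_nat_finite[OF J] by (auto simp: atLeast0LessThan)
    define C where "C i = (if i < card J then B (h i) else {})" for i
    have hJ: "h i \<in> J" if "i < card J" for i using h that by (auto simp: bij_betw_def)
    have "(\<Union>i. C i) = (\<Union>j\<in>h ` {..<card J}. B j)" by (auto simp: C_def split: if_splits)
    then have cov: "A \<subseteq> (\<Union>i. C i)" using B(3) bij_betw_imp_surj_on[OF h] by simp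
    have e0: "ediam d {} = 0" by (simp add: ediam_def bot_ennreal)
    have C1: "C i \<subseteq> M \<and> ediam d (C i) \<le> ennreal \<delta>" for i
      using B(1,2)[OF hJ[of i]] r by (auto simp: C_def e0 intro: order.trans ennreal_leI)
    have dp: "diam_power d s (C i) \<le> ennreal (r powr s)" for i
    proof (cases "i < card J")
      case True
      then have "enn2real (ediam d (C i)) \<le> r"
        using B(2)[OF hJ[of i]] r by (simp add: C_def enn2real_leI)
      then show ?thesis using \<open>s > 0\<close> by (auto simp: diam_power_def intro!: ennreal_leI powr_mono2)
    qed (simp add: C_def diam_power_def)
    have "hausdorff_premeasure M d s \<delta> A \<le> (\<Sum>i. diam_power d s (C i))"
      unfolding hausdorff_premeasure_def using cov C1 by (intro INF_lower) auto
    also have "\<dots> = (\<Sum>i<card J. diam_power d s (C i))"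
      by (intro suminf_finite) (auto simp: C_def diam_power_def)
    also have "\<dots> \<le> (\<Sum>i<card J. ennreal (r powr s))"
      by (intro sum_mono dp)
    also have "\<dots> = ennreal (real (card J) * r powr s)"
      by (simp add: ennreal_mult ennreal_of_nat_eq_real_of_nat)
    also have "\<dots> \<le> ennreal \<epsilon>" using small by (rule ennreal_leI)
    finally show ?thesis by simp
  qed
  have "hausdorff_premeasure M d s \<delta> A \<le> 0" if "\<delta> > 0" for \<delta>
    by (rule ennreal_le_epsilon) (rule le[OF that])
  then show ?thesis
    unfolding hausdorff_measure_def by (intro antisym SUP_least) auto
qed

lemma hausdorff_dim_le:
  assumes "0 \<le> \<beta>" "\<And>s. s > \<beta> \<Longrightarrow> hausdorff_measure M d s A = 0"
  shows "hausdorff_dim M d A \<le> ennreal \<beta>"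
proof (rule ennreal_le_epsilon)
  fix e :: real assume "0 < e"
  then show "hausdorff_dim M d A \<le> ennreal \<beta> + ennreal e"
    unfolding hausdorff_dim_def using assms
    by (subst ennreal_plus[symmetric]) (auto intro!: Inf_lower exI[of _ "\<beta> + e"])
qed

lemma hausdorff_dim_singleton:
  assumes "p \<in> M" "d p p = 0"
  shows "hausdorff_dim M d {p} = 0"
proof -
  have "hausdorff_measure M d s {p} = 0" if "s > 0" for s
  proof (rule hausdorff_measure_eq_0I[OF that])
    fix \<delta> :: real assume "\<delta> > 0"
    show "\<exists>(J :: unit set) B r. finite J \<and> 0 \<le> r \<and> r \<le> \<delta>
        \<and> (\<forall>j\<in>J. B j \<subseteq> M \<and> ediam d (B j) \<le> ennreal r) \<and> {p} \<subseteq> (\<Union>j\<in>J. B j)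
        \<and> real (card J) * r powr s \<le> \<delta>"
      by (rule exI[of _ UNIV], rule exI[of _ "\<lambda>_. {p}"], rule exI[of _ 0])
         (use assms \<open>\<delta> > 0\<close> in \<open>simp add: ediam_def\<close>)
  qed
  then show ?thesis using hausdorff_dim_le[of 0 M d "{p}"] by simp
qed

text \<open>
  A lower bound for the sums with exponent \<open>\<beta>\<close> is also one for every smaller exponent, since
  the sets have diameter at most \<open>1\<close>.
\<close>
lemma mass_distribution_principle:
  assumes "\<beta> > 0" "c > 0"
    and cover: "\<And>C. (\<And>i. C i \<subseteq> M) \<Longrightarrow> (\<And>i. ediam d (C i) \<le> 1) \<Longrightarrow> A \<subseteq> (\<Union>i. C i) \<Longrightarrow>
        ennreal c \<le> (\<Sum>i::nat. ennreal (enn2real (ediam d (C i)) powr \<beta>))"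
  shows "ennreal \<beta> \<le> hausdorff_dim M d A"
  unfolding hausdorff_dim_def
proof (rule Inf_greatest, clarify)
  fix s assume "0 \<le> s" and zero: "hausdorff_measure M d s A = 0"
  have "\<not> s < \<beta>"
  proof
    assume "s < \<beta>"
    have "hausdorff_premeasure M d s 1 A \<le> hausdorff_measure M d s A"
      unfolding hausdorff_measure_def by (intro SUP_upper) auto
    then have "hausdorff_premeasure M d s 1 A < ennreal c" using zero \<open>c > 0\<close> by simp
    then obtain C where C: "\<And>i. C i \<subseteq> M" "\<And>i. ediam d (C i) \<le> 1" "A \<subseteq> (\<Union>i. C i)"
      and less: "(\<Sum>i. diam_power d s (C i)) < ennreal c"
      unfolding hausdorff_premeasure_def INF_less_iff ennreal_1 by blast
    have "ennreal (enn2real (ediam d (C i)) powr \<beta>) \<le> diam_power d s (C i)" for i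
    proof -
      have "enn2real (ediam d (C i)) \<le> 1" using C(2)[of i] by (intro enn2real_leI) auto
      then have "enn2real (ediam d (C i)) powr \<beta> \<le> enn2real (ediam d (C i)) powr s"
        and "enn2real (ediam d (C i)) powr \<beta> \<le> 1"
        using \<open>\<beta> > 0\<close> \<open>s < \<beta>\<close> by (auto intro: powr_mono' powr_le1)
      moreover have "ediam d {} = 0" by (simp add: ediam_def bot_ennreal)
      ultimately show ?thesis
        using \<open>\<beta> > 0\<close> ennreal_leI[of _ 1] by (auto simp: diam_power_def ennreal_leI)
    qed
    then have "(\<Sum>i. ennreal (enn2real (ediam d (C i)) powr \<beta>)) \<le> (\<Sum>i. diam_power d s (C i))"
      by (intro suminf_le) auto
    with cover[OF C] less show False by auto
  qed
  then show "ennreal \<beta> \<le> ennreal s" by (simp add: ennreal_leI)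
qed

section \<open>Products of Cantor sets in a slice\<close>

text \<open>
  The homogeneous dimension of a slice: the coordinate \<open>u\<^sub>s\<close> scales with weight \<open>k + 1 - s\<close>.
\<close>
definition jet_degree :: "nat \<Rightarrow> nat" where
  "jet_degree k = (\<Sum>s\<le>k. k + 1 - s)"

lemma jet_degree_eq: "real (jet_degree k) = real ((k + 1) * (k + 2)) / 2"
proof -
  have "(\<Sum>s\<le>k. k + 1 - s) = (\<Sum>s\<le>k. s + 1)"
    by (rule sum.reindex_bij_witness[of _ "\<lambda>s. k - s" "\<lambda>s. k - s"]) auto
  moreover have "2 * (\<Sum>s\<le>k. s + 1) = (k + 1) * (k + 2)" by (induction k) auto
  ultimately have "2 * jet_degree k = (k + 1) * (k + 2)" by (simp add: jet_degree_def)
  then have "2 * real (jet_degree k) = real ((k + 1) * (k + 2))"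
    by (metis of_nat_mult of_nat_numeral)
  then show ?thesis by simp
qed

lemma jet_degree_pos: "jet_degree k > 0"
  unfolding jet_degree_def by (rule sum_pos) auto

lemma compact_coordinate_product:
  fixes C :: "nat \<Rightarrow> real set"
  assumes "\<And>s. compact (C s)"
  shows "compact {u. \<forall>s. u s \<in> C s}"
proof -
  have "compactin (product_topology (\<lambda>_. euclidean) UNIV) (PiE UNIV C)"
    using assms by (simp add: compactin_PiE compactin_euclidean_iff)
  then show ?thesis
    by (simp add: euclidean_product_topology compactin_euclidean_iff PiE_def Pi_def)
qed

text \<open>
  The part of the Cantor set coded by the \<open>j\<close>-th dyadic interval of level \<open>m\<close>.
\<close>
definition coded_cell :: "(real \<Rightarrow> real) \<Rightarrow> nat \<Rightarrow> int \<Rightarrow> real set" where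
  "coded_cell G m j = closure (G ` {y \<in> {0..<1}. \<lfloor>2 ^ m * y\<rfloor> = j})"

text \<open>
  The product of \<open>k + 1\<close> copies of the Cantor set in the slice \<open>{x = t}\<close>, translated by \<open>- g\<close>.
\<close>
definition coded_translate :: "nat \<Rightarrow> (real \<Rightarrow> real) \<Rightarrow> real \<Rightarrow> (nat \<Rightarrow> real) \<Rightarrow> jet set" where
  "coded_translate k G t g = {p. fst p = t \<and>
      (\<forall>s. snd p s + g s \<in> (if s \<le> k then closure (G ` {0..<1}) else {0}))}"

context
  fixes k :: nat and \<theta> :: real and G :: "real \<Rightarrow> real" and K :: real
  assumes \<theta>: "0 < \<theta>" "\<theta> \<le> 1" and coding: "cantor_coding \<theta> K G"
begin

lemma coding_constant_ge_1: "K \<ge> 1"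
  and coding_hoelder:
    "x \<in> {0..<1} \<Longrightarrow> y \<in> {0..<1} \<Longrightarrow> \<bar>x - y\<bar> \<le> K * \<bar>G x - G y\<bar> powr \<theta>"
  and coding_cell:
    "x \<in> {0..<1} \<Longrightarrow> y \<in> {0..<1} \<Longrightarrow> \<lfloor>2 ^ m * x\<rfloor> = \<lfloor>2 ^ m * y\<rfloor> \<Longrightarrow>
       \<bar>G x - G y\<bar> \<le> K * (2 powr (- 1 / \<theta>)) ^ m"
  using coding unfolding cantor_coding_def by blast+

lemma coded_cell_diameter:
  assumes "a \<in> coded_cell G m j" "b \<in> coded_cell G m j"
  shows "\<bar>a - b\<bar> \<le> K * (2 powr (- 1 / \<theta>)) ^ m"
proof -
  let ?S = "G ` {y \<in> {0..<1}. \<lfloor>2 ^ m * y\<rfloor> = j}" and ?R = "K * (2 powr (- 1 / \<theta>)) ^ m"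
  have 1: "\<bar>x - y\<bar> \<le> ?R" if "x \<in> ?S" "y \<in> ?S" for x y
    using that coding_cell by auto
  have "closure ?S \<subseteq> cball x ?R" if "x \<in> ?S" for x
    using 1[OF that] by (intro closure_minimal) (auto simp: dist_real_def)
  then have "?S \<subseteq> cball b ?R" using assms(2)
    by (force simp: coded_cell_def dist_commute)
  then have "closure ?S \<subseteq> cball b ?R" by (intro closure_minimal) auto
  then show ?thesis using assms(1) by (auto simp: coded_cell_def dist_real_def abs_minus_commute)
qed

lemma coded_set_subset_cells:
  "closure (G ` {0..<1}) \<subseteq> (\<Union>j\<in>{0..<2 ^ m}. coded_cell G m j)"
proof (rule closure_minimal)
  show "closed (\<Union>j\<in>{0..<2 ^ m}. coded_cell G m j)"
    by (intro closed_UN) (auto simp: coded_cell_def)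
  show "G ` {0..<1} \<subseteq> (\<Union>j\<in>{0..<2 ^ m}. coded_cell G m j)"
  proof
    fix x assume "x \<in> G ` {0..<1}"
    then obtain y where y: "y \<in> {0..<1}" "x = G y" by blast
    then have "0 \<le> 2 ^ m * y" "2 ^ m * y < 2 ^ m" by auto
    then have "\<lfloor>2 ^ m * y\<rfloor> \<in> {0..<2 ^ m}" by (auto simp: floor_less_iff)
    moreover have "x \<in> coded_cell G m \<lfloor>2 ^ m * y\<rfloor>"
      unfolding coded_cell_def using y by (intro subsetD[OF closure_subset]) auto
    ultimately show "x \<in> (\<Union>j\<in>{0..<2 ^ m}. coded_cell G m j)" by blast
  qed
qed

lemma compact_coded_set: "compact (closure (G ` {0..<1}))"
proof -
  have "\<bar>x - y\<bar> \<le> K" if "x \<in> coded_cell G 0 0" "y \<in> coded_cell G 0 0" for x y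
    using coded_cell_diameter[OF that] by simp
  then have "bounded (coded_cell G 0 0)"
    unfolding bounded_two_points dist_real_def by blast
  moreover have "closure (G ` {0..<1}) \<subseteq> coded_cell G 0 0"
  proof -
    have "{0..<2 ^ 0} = {0 :: int}" by auto
    then show ?thesis using coded_set_subset_cells[of 0] by simp
  qed
  ultimately have "bounded (closure (G ` {0..<1}))" by (rule bounded_subset)
  then show ?thesis by (simp add: compact_eq_bounded_closed)
qed

text \<open>
  The boxes \<open>B m j\<close> use the level \<open>m (k + 1 - s)\<close> in coordinate \<open>s\<close>, so that all their sides
  correspond to the same \<open>d_cc\<close>-scale \<open>\<lambda> ^ m\<close>.
\<close>
lemma hausdorff_dim_coded_translate_le:
  assumes g: "\<And>s. s > k \<Longrightarrow> g s = 0"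
  shows "jet_hausdorff_dim k (coded_translate k G t g) \<le> ennreal (\<theta> * jet_degree k)"
proof (rule hausdorff_dim_le)
  show nonneg: "0 \<le> \<theta> * jet_degree k" using \<theta> by simp
  fix \<sigma> assume \<sigma>: "\<theta> * jet_degree k < \<sigma>"
  with nonneg have "\<sigma> > 0" by linarith
  define l where "l = 2 powr (- 1 / \<theta>)"
  have l: "0 < l" "l < 1"
    using \<theta> powr_less_mono[of "- 1 / \<theta>" 0 2] by (auto simp: l_def)
  obtain K2 :: real where K2: "K2 > 0"
    "\<And>p q r. p \<in> jet_space k \<Longrightarrow> q \<in> jet_space k \<Longrightarrow> fst p = fst q \<Longrightarrow> r > 0 \<Longrightarrow>
       (\<And>s. s \<le> k \<Longrightarrow> \<bar>snd q s - snd p s\<bar> \<le> r ^ (k + 1 - s)) \<Longrightarrow> d_cc k p q \<le> ennreal (K2 * r)"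
    using d_cc_vertical_upper_bound[of k] by blast
  define J where "J m = PiE {..k} (\<lambda>s. {0..<2 ^ (m * (k + 1 - s)) :: int})" for m
  define B where "B m j = {p \<in> jet_space k. fst p = t \<and>
      (\<forall>s\<le>k. snd p s + g s \<in> coded_cell G (m * (k + 1 - s)) (j s))}" for m j
  define r where "r m = K2 * (K * l ^ m)" for m
  have r0: "0 \<le> r m" for m using coding_constant_ge_1 K2(1) l by (simp add: r_def)
  have fin: "finite (J m)" for m unfolding J_def by (intro finite_PiE) auto
  have card: "real (card (J m)) = (2 ^ jet_degree k) ^ m" for m
  proof -
    have "card (J m) = (\<Prod>s\<le>k. 2 ^ (m * (k + 1 - s)))"
      by (simp add: J_def card_PiE nat_power_eq)
    also have "\<dots> = 2 ^ (m * jet_degree k)"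
      by (simp only: jet_degree_def sum_distrib_left power_sum)
    finally show ?thesis by (simp add: mult.commute flip: power_mult)
  qed
  have diam: "ediam (d_cc k) (B m j) \<le> ennreal (r m)" for m j
  proof (rule ediam_least)
    fix p q assume p: "p \<in> B m j" and q: "q \<in> B m j"
    show "d_cc k p q \<le> ennreal (r m)"
      unfolding r_def
    proof (rule K2(2))
      show "K * l ^ m > 0" using coding_constant_ge_1 l by simp
      fix s assume "s \<le> k"
      then have "\<bar>(snd q s + g s) - (snd p s + g s)\<bar> \<le> K * l ^ (m * (k + 1 - s))"
        unfolding l_def using p q by (intro coded_cell_diameter) (auto simp: B_def)
      also have "\<dots> \<le> K ^ (k + 1 - s) * l ^ (m * (k + 1 - s))"
        using coding_constant_ge_1 l \<open>s \<le> k\<close> power_increasing[of 1 "k + 1 - s" K] by (intro mult_right_mono) auto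
      also have "\<dots> = (K * l ^ m) ^ (k + 1 - s)" by (simp add: power_mult_distrib power_mult)
      finally show "\<bar>snd q s - snd p s\<bar> \<le> (K * l ^ m) ^ (k + 1 - s)" by simp
    qed (use p q in \<open>auto simp: B_def\<close>)
  qed
  have cov: "coded_translate k G t g \<subseteq> (\<Union>j\<in>J m. B m j)" for m
  proof
    fix p assume "p \<in> coded_translate k G t g"
    then have "fst p = t" and p: "snd p s + g s \<in> (if s \<le> k then closure (G ` {0..<1}) else {0})" for s
      unfolding coded_translate_def by blast+
    have "\<exists>j\<in>{0..<2 ^ (m * (k + 1 - s))}. snd p s + g s \<in> coded_cell G (m * (k + 1 - s)) j" if "s \<le> k" for s
      using p[of s] that coded_set_subset_cells[of "m * (k + 1 - s)"] by (auto dest: subsetD)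
    then obtain j where j: "\<And>s. s \<le> k \<Longrightarrow> j s \<in> {0..<2 ^ (m * (k + 1 - s))}
        \<and> snd p s + g s \<in> coded_cell G (m * (k + 1 - s)) (j s)"
      by metis
    have "snd p s = 0" if "s > k" for s
      using p[of s] that g[OF that] by simp
    then have "p \<in> B m (restrict j {..k})" using j \<open>fst p = t\<close> by (auto simp: B_def jet_space_def)
    moreover have "restrict j {..k} \<in> J m" unfolding J_def using j by (auto intro!: restrict_PiE)
    ultimately show "p \<in> (\<Union>j\<in>J m. B m j)" by blast
  qed
  have rs: "r m powr \<sigma> = (K2 * K) powr \<sigma> * (l powr \<sigma>) ^ m" for m
    by (simp add: r_def powr_mult power_powr_swap mult.assoc)
  \<comment> \<open>At exponent \<open>\<sigma>\<close> the sums over the boxes decay geometrically in \<open>m\<close>, as \<open>\<sigma>\<close> exceeds \<open>\<theta> Q\<close>.\<close>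
  have q: "2 ^ jet_degree k * l powr \<sigma> < 1"
  proof -
    have "2 ^ jet_degree k * l powr \<sigma> = 2 powr (jet_degree k - \<sigma> / \<theta>)"
      unfolding l_def powr_powr by (simp add: powr_realpow powr_diff powr_minus_divide)
    also have "\<dots> < 2 powr 0"
      using \<sigma> \<theta> by (intro powr_less_mono) (auto simp: field_simps)
    finally show ?thesis by simp
  qed
  have "(\<lambda>m. (K2 * K) powr \<sigma> * (2 ^ jet_degree k * l powr \<sigma>) ^ m) \<longlonglongrightarrow> (K2 * K) powr \<sigma> * 0"
    using q by (intro tendsto_mult tendsto_const LIMSEQ_realpow_zero) auto
  then have lim1: "(\<lambda>m. real (card (J m)) * r m powr \<sigma>) \<longlonglongrightarrow> 0"
    by (simp add: card rs power_mult_distrib mult.left_commute)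
  have "(\<lambda>m. K2 * (K * l ^ m)) \<longlonglongrightarrow> K2 * (K * 0)"
    using l by (intro tendsto_mult tendsto_const LIMSEQ_realpow_zero) auto
  then have lim2: "r \<longlonglongrightarrow> 0" by (simp add: r_def[abs_def])
  show "hausdorff_measure (jet_space k) (d_cc k) \<sigma> (coded_translate k G t g) = 0"
  proof (rule hausdorff_measure_eq_0I[OF \<open>\<sigma> > 0\<close>])
    fix \<delta> :: real assume "\<delta> > 0"
    have "\<forall>\<^sub>F m in sequentially. real (card (J m)) * r m powr \<sigma> < \<delta> \<and> r m < \<delta>"
      using order_tendstoD(2)[OF lim1 \<open>\<delta> > 0\<close>] order_tendstoD(2)[OF lim2 \<open>\<delta> > 0\<close>]
      by eventually_elim simp
    then obtain m where m: "real (card (J m)) * r m powr \<sigma> < \<delta>" "r m < \<delta>"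
      by (auto simp: eventually_sequentially)
    show "\<exists>(J :: (nat \<Rightarrow> int) set) B r. finite J \<and> 0 \<le> r \<and> r \<le> \<delta>
        \<and> (\<forall>j\<in>J. B j \<subseteq> jet_space k \<and> ediam (d_cc k) (B j) \<le> ennreal r)
        \<and> coded_translate k G t g \<subseteq> (\<Union>j\<in>J. B j) \<and> real (card J) * r powr \<sigma> \<le> \<delta>"
      by (rule exI[of _ "J m"], rule exI[of _ "B m"], rule exI[of _ "r m"])
         (use m fin r0 cov diam in \<open>auto simp: B_def\<close>)
  qed
qed

text \<open>
  A cover of the set is pulled back by \<open>G\<close> in every coordinate to a cover of the unit cube, whose
  volume is \<open>1\<close>; the piece coming from a set of diameter \<open>e\<close> lies in a box of volume at most
  \<open>(2 K) ^ (k + 1)\<close> times \<open>e powr (\<theta> Q)\<close>.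
\<close>
lemma hausdorff_dim_coded_translate_ge:
  assumes g: "\<And>s. s > k \<Longrightarrow> g s = 0"
  shows "ennreal (\<theta> * jet_degree k) \<le> jet_hausdorff_dim k (coded_translate k G t g)"
proof (rule mass_distribution_principle)
  show "0 < \<theta> * jet_degree k" using \<theta> jet_degree_pos by simp
  show "0 < 1 / (2 * K) ^ (k + 1)" using coding_constant_ge_1 by simp
  fix C :: "nat \<Rightarrow> jet set"
  assume diam: "\<And>i. ediam (d_cc k) (C i) \<le> 1" and cov: "coded_translate k G t g \<subseteq> (\<Union>i. C i)"
  interpret product_sigma_finite "\<lambda>_. lborel :: real measure" ..
  let ?P = "Pi\<^sub>M {..k} (\<lambda>_. lborel :: real measure)"
  let ?I = "PiE {..k} (\<lambda>_. {0..<1::real})"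
  define pt :: "(nat \<Rightarrow> real) \<Rightarrow> jet" where "pt y = (t, \<lambda>s. if s \<le> k then G (y s) - g s else 0)" for y
  define e where "e i = enn2real (ediam (d_cc k) (C i))" for i
  define T where "T i = {y \<in> ?I. pt y \<in> C i}" for i
  have pt: "pt y \<in> coded_translate k G t g" if "y \<in> ?I" for y
  proof -
    have "G (y s) \<in> closure (G ` {0..<1})" if "s \<le> k" for s
      using \<open>y \<in> ?I\<close> that by (intro subsetD[OF closure_subset] imageI) (auto simp: PiE_iff)
    then show ?thesis using g by (auto simp: coded_translate_def pt_def)
  qed
  \<comment> \<open>Half the side lengths of the box \<open>Bx i\<close> around \<open>T i\<close>, which is centred at a point of \<open>T i\<close>.\<close>
  define \<rho> where "\<rho> i s = K * (e i ^ (k + 1 - s)) powr \<theta>" for i s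
  have e0: "0 \<le> e i" for i by (simp add: e_def)
  have close: "\<bar>y s - z s\<bar> \<le> \<rho> i s" if "y \<in> T i" "z \<in> T i" "s \<le> k" for i y z s
  proof -
    have "d_cc k (pt z) (pt y) \<le> ediam (d_cc k) (C i)"
      using that by (intro le_ediam) (auto simp: T_def)
    also have "\<dots> = ennreal (e i)"
      using diam[of i] order.strict_trans1[OF diam[of i] ennreal_one_less_top] by (simp add: e_def)
    finally have "\<bar>snd (pt y) s - snd (pt z) s\<bar> \<le> e i ^ (k + 1 - s)"
      using \<open>s \<le> k\<close> by (intro d_cc_vertical_lower_bound e0) (auto simp: pt_def)
    then have "\<bar>G (y s) - G (z s)\<bar> powr \<theta> \<le> (e i ^ (k + 1 - s)) powr \<theta>"
      using \<theta> \<open>s \<le> k\<close> by (intro powr_mono2) (auto simp: pt_def)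
    then have "K * \<bar>G (y s) - G (z s)\<bar> powr \<theta> \<le> \<rho> i s"
      using coding_constant_ge_1 by (simp add: \<rho>_def)
    moreover have "\<bar>y s - z s\<bar> \<le> K * \<bar>G (y s) - G (z s)\<bar> powr \<theta>"
      using that by (intro coding_hoelder) (auto simp: T_def PiE_iff)
    ultimately show ?thesis by linarith
  qed
  define Bx where "Bx i = (if T i = {} then {} else
     PiE {..k} (\<lambda>s. {(SOME z. z \<in> T i) s - \<rho> i s..(SOME z. z \<in> T i) s + \<rho> i s}))" for i
  have sub: "T i \<subseteq> Bx i" for i
  proof
    fix y assume y: "y \<in> T i"
    then have z: "(SOME z. z \<in> T i) \<in> T i" by (rule someI[of "\<lambda>z. z \<in> T i"])
    then have "T i \<noteq> {}" by blast
    moreover have "y \<in> extensional {..k}" using y by (auto simp: T_def PiE_def)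
    ultimately show "y \<in> Bx i"
      using close[OF y z] by (auto simp: Bx_def PiE_iff abs_le_iff algebra_simps)
  qed
  have meas: "Bx i \<in> sets ?P" for i
    by (auto simp: Bx_def intro!: sets_PiM_I_finite)
  have vol: "emeasure ?P (Bx i) \<le> ennreal ((2 * K) ^ (k + 1)) * ennreal (e i powr (\<theta> * jet_degree k))" for i
  proof (cases "T i = {}")
    case False
    have \<rho>0: "0 \<le> \<rho> i s" for s using coding_constant_ge_1 by (simp add: \<rho>_def)
    have "emeasure ?P (Bx i) = (\<Prod>s\<le>k. ennreal (2 * \<rho> i s))"
      using False \<rho>0 by (simp add: Bx_def emeasure_PiM)
    also have "\<dots> = ennreal (\<Prod>s\<le>k. (2 * K) * (e i ^ (k + 1 - s)) powr \<theta>)"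
      using \<rho>0 by (simp add: prod_ennreal \<rho>_def mult.assoc)
    also have "(\<Prod>s\<le>k. (2 * K) * (e i ^ (k + 1 - s)) powr \<theta>)
        = (2 * K) ^ (k + 1) * (\<Prod>s\<le>k. e i ^ (k + 1 - s)) powr \<theta>"
      using e0[of i] by (simp add: prod.distrib prod_powr_distrib)
    also have "(\<Prod>s\<le>k. e i ^ (k + 1 - s)) = e i ^ jet_degree k"
      by (simp add: jet_degree_def power_sum)
    also have "(e i ^ jet_degree k) powr \<theta> = e i powr (\<theta> * jet_degree k)"
      using jet_degree_pos[of k] \<theta> powr_realpow[of "e i powr \<theta>" "jet_degree k"]
      by (cases "e i = 0") (simp_all add: power_powr_swap powr_powr)
    finally show ?thesis using coding_constant_ge_1 by (simp add: ennreal_mult)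
  qed (simp add: Bx_def)
  have "?I \<subseteq> (\<Union>i. T i)"
  proof
    fix y assume y: "y \<in> ?I"
    then obtain i where "pt y \<in> C i" using pt cov by blast
    then show "y \<in> (\<Union>i. T i)" using y by (auto simp: T_def)
  qed
  then have "?I \<subseteq> (\<Union>i. Bx i)" using sub by blast
  have "1 = emeasure ?P ?I" by (simp add: emeasure_PiM)
  also have "\<dots> \<le> emeasure ?P (\<Union>i. Bx i)"
    using \<open>?I \<subseteq> (\<Union>i. Bx i)\<close> meas by (intro emeasure_mono) auto
  also have "\<dots> \<le> (\<Sum>i. emeasure ?P (Bx i))"
    using meas by (intro emeasure_subadditive_countably) auto
  also have "\<dots> \<le> (\<Sum>i. ennreal ((2 * K) ^ (k + 1)) * ennreal (e i powr (\<theta> * jet_degree k)))"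
    by (intro suminf_le vol) auto
  also have "\<dots> = ennreal ((2 * K) ^ (k + 1)) * (\<Sum>i. ennreal (e i powr (\<theta> * jet_degree k)))"
    by (rule ennreal_suminf_cmult)
  finally have "ennreal (1 / (2 * K) ^ (k + 1)) * 1 \<le> ennreal (1 / (2 * K) ^ (k + 1)) *
      (ennreal ((2 * K) ^ (k + 1)) * (\<Sum>i. ennreal (e i powr (\<theta> * jet_degree k))))"
    by (rule mult_left_mono) simp
  also have "\<dots> = (\<Sum>i. ennreal (e i powr (\<theta> * jet_degree k)))"
    using coding_constant_ge_1 by (simp add: mult.assoc[symmetric] ennreal_mult[symmetric] del: power_Suc)
  finally show "ennreal (1 / (2 * K) ^ (k + 1))
      \<le> (\<Sum>i. ennreal (enn2real (ediam (d_cc k) (C i)) powr (\<theta> * jet_degree k)))"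
    by (simp add: e_def)
qed

end

section \<open>Vertical and horizontal images\<close>

text \<open>
  On the slice the second factor of the product has \<open>x\<close>-coordinate \<open>0\<close>, which kills all mixed
  terms of the group law: right multiplication is a translation.
\<close>
lemma vertical_map_on_slice:
  assumes "p \<in> jet_slice k t"
  shows "vertical_map k f t p = (t, \<lambda>s. snd p s - snd (jet_of k f 0) s)"
proof -
  interpret group "jet_group k" by (rule group_jet_group)
  define g where "g = jet_of k f 0"
  define g' :: jet where "g' = (0, \<lambda>s. - snd g s)"
  have right: "jet_mult k q (0, v) = (fst q, \<lambda>s. if s \<le> k then snd q s + v s else 0)" for q v
    by (auto simp: jet_mult_def fun_eq_iff power_0_left intro!: sum.neutral)
  have g: "g \<in> carrier (jet_group k)" "g' \<in> carrier (jet_group k)"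
    by (auto simp: g_def g'_def jet_of_def jet_group_def jet_space_def)
  have "g' \<otimes>\<^bsub>jet_group k\<^esub> g = \<one>\<^bsub>jet_group k\<^esub>"
  proof -
    have "jet_mult k g' g = jet_mult k g' (0, snd g)" by (simp add: g_def jet_of_def)
    then show ?thesis by (simp add: right g'_def jet_group_def fun_eq_iff)
  qed
  then have "inv\<^bsub>jet_group k\<^esub> g = g'"
    using g by (intro inv_equality) auto
  moreover have "fst p = t" "\<And>s. s > k \<Longrightarrow> snd p s = 0"
    using assms by (auto simp: jet_slice_def jet_space_def)
  moreover have "snd g s = 0" if "s > k" for s using that by (simp add: g_def jet_of_def)
  ultimately show ?thesis
    by (auto simp: vertical_map_def g_def[symmetric] jet_group_def right g'_def fun_eq_iff)
qed

theorem corollary4p6: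
  fixes k :: nat and t \<beta> :: real
  assumes "k \<ge> 1" and "0 \<le> \<beta>" and "\<beta> \<le> real ((k + 1) * (k + 2)) / 2"
  shows "\<exists>E. compact E \<and> E \<subseteq> jet_slice k t \<and>
           (\<forall>f. smooth f \<longrightarrow>
              jet_hausdorff_dim k (vertical_map k f t ` E) = ennreal \<beta> \<and>
              jet_hausdorff_dim k (horizontal_map k f t ` E) = 0)"
proof -
  have "\<exists>E. compact E \<and> E \<noteq> {} \<and> E \<subseteq> jet_slice k t \<and>
      (\<forall>g. (\<forall>s>k. g s = 0) \<longrightarrow> jet_hausdorff_dim k ((\<lambda>p. (t, \<lambda>s. snd p s - g s)) ` E) = ennreal \<beta>)"
  \<comment> \<open>For \<open>\<beta> = 0\<close> the ratio \<open>2 powr (- 1 / \<theta>)\<close> would degenerate, and a single point does.\<close>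
  proof (cases "\<beta> = 0")
    case True
    show ?thesis
      by (rule exI[of _ "{(t, \<lambda>_. 0)}"])
         (auto simp: True jet_slice_def jet_space_def intro!: hausdorff_dim_singleton d_cc_refl)
  next
    case False
    define \<theta> where "\<theta> = \<beta> / jet_degree k"
    have Q: "\<beta> \<le> jet_degree k" using assms(3) by (simp add: jet_degree_eq)
    have \<theta>: "0 < \<theta>" "\<theta> \<le> 1" and \<beta>: "\<theta> * jet_degree k = \<beta>"
      using False assms(2) Q by (auto simp: \<theta>_def field_simps)
    obtain K G where GK: "cantor_coding \<theta> K G"
      using cantor_coding_exists[OF \<theta>] by blast
    let ?E = "coded_translate k G t (\<lambda>_. 0)"
    have "compact {u. \<forall>s. u s \<in> (if s \<le> k then closure (G ` {0..<1}) else {0})}"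
    proof (rule compact_coordinate_product)
      show "compact (if s \<le> k then closure (G ` {0..<1}) else {0})" for s
        using compact_coded_set[OF \<theta> GK] by (cases "s \<le> k") simp_all
    qed
    then have "compact ({t} \<times> {u. \<forall>s. u s \<in> (if s \<le> k then closure (G ` {0..<1}) else {0})})"
      by (intro compact_Times) auto
    also have "{t} \<times> {u. \<forall>s. u s \<in> (if s \<le> k then closure (G ` {0..<1}) else {0})} = ?E"
      by (auto simp: coded_translate_def)
    finally have "compact ?E" .
    moreover have "?E \<noteq> {}"
    proof -
      have "G 0 \<in> closure (G ` {0..<1})" by (intro subsetD[OF closure_subset] imageI) auto
      then have "(t, \<lambda>s. if s \<le> k then G 0 else 0) \<in> ?E" by (auto simp: coded_translate_def)
      then show ?thesis by blast
    qed
    moreover have "?E \<subseteq> jet_slice k t"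
    proof
      fix p assume "p \<in> ?E"
      then have "fst p = t" and p: "snd p s + 0 \<in> (if s \<le> k then closure (G ` {0..<1}) else {0})" for s
        unfolding coded_translate_def by blast+
      have "snd p s = 0" if "s > k" for s
        using p[of s] that by simp
      then show "p \<in> jet_slice k t" using \<open>fst p = t\<close> by (simp add: jet_slice_def jet_space_def)
    qed
    moreover have "jet_hausdorff_dim k ((\<lambda>p. (t, \<lambda>s. snd p s - g s)) ` ?E) = ennreal \<beta>"
      if g: "\<forall>s>k. g s = 0" for g
    proof -
      have "(\<lambda>p. (t, \<lambda>s. snd p s - g s)) ` ?E = coded_translate k G t g"
      proof (intro equalityI subsetI)
        fix p assume "p \<in> coded_translate k G t g"
        then show "p \<in> (\<lambda>p. (t, \<lambda>s. snd p s - g s)) ` ?E"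
          by (intro image_eqI[of _ _ "(t, \<lambda>s. snd p s + g s)"])
             (auto simp: coded_translate_def prod_eq_iff)
      qed (auto simp: coded_translate_def split del: if_split)
      then show ?thesis
        using hausdorff_dim_coded_translate_le[OF \<theta> GK, of k g t]
          hausdorff_dim_coded_translate_ge[OF \<theta> GK, of k g t] g
        by (simp add: \<beta> antisym)
    qed
    ultimately show ?thesis by blast
  qed
  then obtain E where E: "compact E" "E \<noteq> {}" "E \<subseteq> jet_slice k t"
    and dim: "\<And>g. (\<forall>s>k. g s = 0) \<Longrightarrow> jet_hausdorff_dim k ((\<lambda>p. (t, \<lambda>s. snd p s - g s)) ` E) = ennreal \<beta>"
    by blast
  have "jet_hausdorff_dim k (vertical_map k f t ` E) = ennreal \<beta>" for f
  proof -
    have "vertical_map k f t ` E = (\<lambda>p. (t, \<lambda>s. snd p s - snd (jet_of k f 0) s)) ` E"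
      using E(3) by (intro image_cong) (auto intro!: vertical_map_on_slice)
    then show ?thesis using dim[of "snd (jet_of k f 0)"] by (simp add: jet_of_def)
  qed
  moreover have "jet_hausdorff_dim k (horizontal_map k f t ` E) = 0" for f
  proof -
    have "horizontal_map k f t ` E = {jet_of k f 0}"
    proof -
      have "horizontal_map k f t ` E = (\<lambda>_. jet_of k f 0) ` E"
        using E(3) by (intro image_cong) (auto simp: horizontal_map_def jet_slice_def)
      then show ?thesis using E(2) by (simp add: image_constant_conv)
    qed
    moreover have "jet_of k f 0 \<in> jet_space k" by (simp add: jet_of_def jet_space_def)
    ultimately show ?thesis by (simp add: hausdorff_dim_singleton d_cc_refl)
  qed
  ultimately show ?thesis using E by blast
qed

end
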